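(* Let $P\subset\mathbb{R}^d$ be a set of $n$ points, $\gamma\in(0,1)$, $\epsilon,\eta_1,\eta_2\in(0,1)$, $\delta\in(0,\gamma/3)$, and $z=\frac{2}{\epsilon}+1$. Run the following algorithm: let $n'=O(\frac1\delta\log\frac1{\eta_1})$, $n''=O(\frac{\gamma}{\delta^2}\log\frac1{\eta_2})$ (with sufficiently large absolute constants), $t'=\frac32(\delta/5+\gamma)n'$, $t''=(1+\frac{\delta}{5\gamma})^2\gamma n''$, $s=\frac{\epsilon}{2+\epsilon}$; pick $p\in P$ uniformly at random and let $T=\{p\}$; for $i=1,\dots,z$: (1) compute an approximate MEB center $o_i$ of $T$, i.e. a point at distance less than $s\frac{\epsilon}{1+\epsilon}\mathbf{Rad}(T)$ from the center of $\mathbf{MEB}(T)$; (2) sample $n'$ points independently and uniformly at random from $P$ and let $Q'$ be the set of the $t'$ sampled points farthest from $o_i$; (3) pick $q\in Q'$ uniformly at random and add it to $T$; (4) sample $n''$ points independently and uniformly at random from $P$ and let $\tilde l_i$ be the $(t''+1)$-th largest distance from these sampled points to $o_i$. Output $\mathbb{B}(o_{\hat i},\tilde l_{\hat i})$ with $\hat i=\arg\min_{1\le i\le z}\tilde l_i$. Then with probability at least $(1-\gamma)\big((1-\eta_1)(1-\eta_2)\frac{\delta/5}{3(\gamma+\delta/5)}\big)^{z}$, the output is a $(1+\epsilon,1-\delta)$-approximation for the MEB with outliers instance $(P,\gamma)$.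
   Context: For a finite set $A\subset\mathbb{R}^d$, $\mathbf{MEB}(A)$ is the closed ball of minimum radius containing $A$ and $\mathbf{Rad}(A)$ its radius; $\mathbb{B}(c,r)$ is the closed Euclidean ball. MEB with outliers: given $n$ points $P\subset\mathbb{R}^d$ and $\gamma\in[0,1)$, find the smallest ball covering $(1-\gamma)n$ points of $P$; $P_{\mathrm{opt}}$ denotes a subset $Q\subset P$ with $|Q|=(1-\gamma)n$ minimizing $\mathbf{Rad}(Q)$. A $(1+\epsilon,1-\delta)$-approximation is a ball covering at least $(1-\delta-\gamma)n$ points of $P$ with radius at most $(1+\epsilon)\mathbf{Rad}(P_{\mathrm{opt}})$. Quantities such as $t',t''$ are assumed to be integers.
   Formalization: When Rad(T)=0 (always in round 1) no point is at distance less than 0 from the center, so o_i is taken to be the exact center; if t' exceeds n', Q' is the whole sample; if t''+1 exceeds n'', the distance estimate is 0. The constants in n', n'' may be any reals at least 10^9. *)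

theory Defs
  imports "HOL-Analysis.Analysis" "HOL-Probability.Probability"
begin

definition is_MEB :: "'a::metric_space set \<Rightarrow> 'a \<Rightarrow> real \<Rightarrow> bool" where
  "is_MEB A c r \<longleftrightarrow> A \<subseteq> cball c r \<and> (\<forall>c' r'. A \<subseteq> cball c' r' \<longrightarrow> r \<le> r')"

(* For a nonempty finite A in a Euclidean space both descriptions are uniquely satisfied. *)
definition Rad :: "'a::metric_space set \<Rightarrow> real" where
  "Rad A = (THE r. \<exists>c. is_MEB A c r)"

definition MEB_center :: "'a::metric_space set \<Rightarrow> 'a" where
  "MEB_center A = (THE c. is_MEB A c (Rad A))"

(* The existence of Q forces (1 - \<gamma>) * card P to be a natural number. *)
definition outlier_opt :: "'a::metric_space set \<Rightarrow> real \<Rightarrow> 'a set \<Rightarrow> bool" where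
  "outlier_opt P \<gamma> Q \<longleftrightarrow>
     Q \<subseteq> P \<and> real (card Q) = (1 - \<gamma>) * real (card P) \<and>
     (\<forall>Q'. Q' \<subseteq> P \<and> real (card Q') = (1 - \<gamma>) * real (card P) \<longrightarrow> Rad Q \<le> Rad Q')"

(* (1 + \<epsilon>, 1 - \<delta>)-approximation; the ball is given by its center and radius. *)
definition outlier_approx ::
  "'a::metric_space set \<Rightarrow> real \<Rightarrow> 'a set \<Rightarrow> real \<Rightarrow> real \<Rightarrow> 'a \<times> real \<Rightarrow> bool" where
  "outlier_approx P \<gamma> Popt \<epsilon> \<delta> B \<longleftrightarrow>
     real (card (P \<inter> cball (fst B) (snd B))) \<ge> (1 - \<delta> - \<gamma>) * real (card P) \<and>
     snd B \<le> (1 + \<epsilon>) * Rad Popt"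

(* If Rad T = 0 (in particular for the initial one-point T) no point has distance less than
   \<xi> * Rad T = 0 from the center, so the exact center is required there. *)
definition approx_MEB_center :: "real \<Rightarrow> 'a::metric_space set \<Rightarrow> 'a \<Rightarrow> bool" where
  "approx_MEB_center \<xi> T c \<longleftrightarrow>
     (if Rad T = 0 then c = MEB_center T else dist c (MEB_center T) < \<xi> * Rad T)"

(* Samples are drawn with replacement, so the selected sample points form a multiset; ties are
   broken arbitrarily, and the whole sample is selected if it has fewer than t points. *)
definition farthest_points :: "nat \<Rightarrow> 'a::metric_space \<Rightarrow> 'a list \<Rightarrow> 'a multiset \<Rightarrow> bool" where
  "farthest_points t c xs Q \<longleftrightarrow>
     Q \<subseteq># mset xs \<and> size Q = min t (length xs) \<and>
     (\<forall>x \<in># Q. \<forall>y \<in># mset xs - Q. dist y c \<le> dist x c)"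

(* k counts from 1. The value 0 beyond the end of the list is the least radius leaving at most
   k - 1 of the points outside when the distances to them are the entries of the list. *)
definition kth_largest :: "nat \<Rightarrow> real list \<Rightarrow> real" where
  "kth_largest k xs = (if 1 \<le> k \<and> k \<le> length xs then rev (sort xs) ! (k - 1) else 0)"

(* meb_rounds ... k T: the list of the pairs (o, l) produced by k rounds started with the set T.
   ctr is the approximate-center subroutine, far selects the farthest sample points. *)
primrec meb_rounds ::
  "'a::metric_space set \<Rightarrow> nat \<Rightarrow> nat \<Rightarrow> nat \<Rightarrow> ('a set \<Rightarrow> 'a) \<Rightarrow> ('a \<Rightarrow> 'a list \<Rightarrow> 'a multiset) \<Rightarrow>
   nat \<Rightarrow> 'a set \<Rightarrow> ('a \<times> real) list pmf" where
  "meb_rounds P n' n'' t'' ctr far 0 T = return_pmf []"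
| "meb_rounds P n' n'' t'' ctr far (Suc k) T =
     do {
       xs \<leftarrow> replicate_pmf n' (pmf_of_set P);
       q \<leftarrow> pmf_of_multiset (far (ctr T) xs);
       ys \<leftarrow> replicate_pmf n'' (pmf_of_set P);
       bs \<leftarrow> meb_rounds P n' n'' t'' ctr far k (insert q T);
       return_pmf ((ctr T, kth_largest (t'' + 1) (map (\<lambda>y. dist y (ctr T)) ys)) # bs)
     }"

definition meb_algorithm ::
  "'a::metric_space set \<Rightarrow> nat \<Rightarrow> nat \<Rightarrow> nat \<Rightarrow> ('a set \<Rightarrow> 'a) \<Rightarrow> ('a \<Rightarrow> 'a list \<Rightarrow> 'a multiset) \<Rightarrow>
   nat \<Rightarrow> ('a \<times> real) pmf" where
  "meb_algorithm P n' n'' t'' ctr far z =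
     do {
       p \<leftarrow> pmf_of_set P;
       bs \<leftarrow> meb_rounds P n' n'' t'' ctr far z {p};
       return_pmf (bs ! arg_min_on (\<lambda>i. snd (bs ! i)) {..<z})
     }"

end

theory Submission
  imports Defs
begin

text \<open>
  Call a round with center \<open>o\<close> good if at most \<open>(\<gamma> + \<delta>/5)n\<close> points of \<open>P\<close> lie outside the ball
  \<open>B(o, (1 + \<epsilon>)R)\<close>, where \<open>R = Rad Popt\<close>. In a bad round more than \<open>\<delta>n/5\<close> points of \<open>Popt\<close> lie
  outside this ball. Either all sampled ones are selected into \<open>Q'\<close>, or \<open>Q'\<close> lies entirely outside
  the ball and contains few outliers; in both cases \<open>q\<close> is one of these points with the required
  probability. Each such \<open>q\<close> enlarges \<open>Rad T\<close> so much that \<open>z\<close> bad rounds in a row would force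
  \<open>Rad T > R\<close>. Hence, starting from \<open>p \<in> Popt\<close>, some round is good. There the radius estimate is
  at most \<open>(1 + \<epsilon>)R\<close>, and in every round the estimated ball covers enough points; then the ball of
  least estimated radius is the required approximation.

  Exponential tail bounds are avoided. The number of selected points of \<open>Popt\<close> outside the ball is
  bounded in expectation, about twice the amount needed, and this leaves room for one-sided
  Chebyshev bounds on the radius estimates. In a good round no point \<open>q\<close> is needed, which frees
  the factor \<open>(\<delta>/5) / (3(\<gamma> + \<delta>/5))\<close>. When \<open>\<eta>\<^sub>1\<close> or \<open>\<eta>\<^sub>2\<close> is close to 1 the samples may be
  small, and there the bounds must be compared with \<open>1 - \<eta>\<^sub>i\<close>, which is then at most a small
  multiple of the sample size.
\<close>

subsection \<open>Minimum enclosing balls\<close>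

lemma radius_nonneg_if_subset_cball:
  assumes "A \<subseteq> cball c r" "A \<noteq> {}"
  shows "0 \<le> r"
  using assms by (metis cball_eq_empty not_le subset_empty)

lemma power2_dist_affine_combination:
  fixes x y z :: "'a::real_inner"
  shows "(dist ((1 - u) *\<^sub>R x + u *\<^sub>R y) z)\<^sup>2
    = (1 - u) * (dist x z)\<^sup>2 + u * (dist y z)\<^sup>2 - u * (1 - u) * (dist x y)\<^sup>2"
  unfolding dist_norm power2_norm_eq_inner by (simp add: algebra_simps inner_commute)

lemma is_MEB_power2_dist_center_le:
  fixes c c' :: "'a::real_inner"
  assumes meb: "is_MEB A c r" and ne: "A \<noteq> {}" and cov: "A \<subseteq> cball c' r'"
  shows "r\<^sup>2 + (dist c c')\<^sup>2 \<le> r'\<^sup>2"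
proof -
  have sub: "A \<subseteq> cball c r" and least: "\<And>c' r'. A \<subseteq> cball c' r' \<Longrightarrow> r \<le> r'"
    using meb unfolding is_MEB_def by auto
  have r: "0 \<le> r" by (rule radius_nonneg_if_subset_cball[OF sub ne])
  have "v * (dist c c')\<^sup>2 \<le> r'\<^sup>2 - r\<^sup>2" if v: "0 < v" "v < 1" for v
  proof -
    define u where "u = 1 - v"
    define m where "m = (1 - u) *\<^sub>R c + u *\<^sub>R c'"
    define b where "b = (1 - u) * r\<^sup>2 + u * r'\<^sup>2 - u * (1 - u) * (dist c c')\<^sup>2"
    have u: "0 < u" "u < 1" unfolding u_def using v by auto
    have power2_dist_m: "(dist m x)\<^sup>2 \<le> b" if "x \<in> A" for x
    proof -
      have "(dist c x)\<^sup>2 \<le> r\<^sup>2" "(dist c' x)\<^sup>2 \<le> r'\<^sup>2"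
        using sub cov that by (auto intro!: power_mono)
      then have "(1 - u) * (dist c x)\<^sup>2 \<le> (1 - u) * r\<^sup>2" "u * (dist c' x)\<^sup>2 \<le> u * r'\<^sup>2"
        using u by (auto intro!: mult_left_mono)
      then show ?thesis
        unfolding m_def b_def power2_dist_affine_combination by linarith
    qed
    then have "r \<le> sqrt b"
      by (intro least[of m]) (auto intro!: real_le_rsqrt)
    moreover have "0 \<le> b"
      using power2_dist_m ne by (meson all_not_in_conv order_trans zero_le_power2)
    ultimately have "r\<^sup>2 \<le> b"
      using r by (metis power_mono real_sqrt_pow2)
    then have "u * (v * (dist c c')\<^sup>2) \<le> u * (r'\<^sup>2 - r\<^sup>2)"
      unfolding b_def u_def by (simp add: algebra_simps)
    then show ?thesis using u by simp
  qed
  then have "(dist c c')\<^sup>2 \<le> r'\<^sup>2 - r\<^sup>2" by (rule field_le_mult_one_interval)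
  then show ?thesis by simp
qed

lemma is_MEB_exists:
  fixes A :: "'a::heine_borel set"
  assumes "bounded A" "A \<noteq> {}"
  shows "\<exists>c r. is_MEB A c r"
proof -
  obtain p where p: "p \<in> A" using assms(2) by blast
  obtain D where D: "A \<subseteq> cball p D"
    using assms(1) unfolding bounded_any_center[of A p] by (auto simp: subset_eq)
  define S where "S = (\<Inter>a\<in>A. {x :: 'a \<times> real. dist (fst x) a \<le> snd x}) \<inter> {x. snd x \<le> D}"
  have mem_S: "(c, r) \<in> S \<longleftrightarrow> A \<subseteq> cball c r \<and> r \<le> D" for c r
    unfolding S_def by auto
  have "closed {x :: 'a \<times> real. dist (fst x) a \<le> snd x}" for a
    by (intro closed_Collect_le continuous_intros)
  moreover have "closed {x :: 'a \<times> real. snd x \<le> D}"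
    by (intro closed_Collect_le continuous_intros)
  ultimately have "closed S"
    unfolding S_def by (simp add: closed_Int closed_INT)
  moreover have "S \<subseteq> cball p D \<times> {0..D}"
  proof
    fix x assume "x \<in> S"
    moreover obtain c r where x: "x = (c, r)" by (cases x)
    ultimately have "A \<subseteq> cball c r" "r \<le> D" by (simp_all add: mem_S)
    moreover from this have "0 \<le> r" "dist c p \<le> r"
      using radius_nonneg_if_subset_cball[of A c r] assms(2) p by auto
    ultimately show "x \<in> cball p D \<times> {0..D}" by (simp add: x dist_commute)
  qed
  then have "bounded S"
    by (rule bounded_subset[OF bounded_Times[OF bounded_cball bounded_closed_interval]])
  ultimately have "compact S" by (simp add: compact_eq_bounded_closed)
  moreover have "(p, D) \<in> S" using D mem_S by simp
  ultimately obtain x where "x \<in> S" "\<forall>y\<in>S. snd x \<le> snd y"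
    using continuous_attains_inf[of S snd] continuous_on_snd[OF continuous_on_id, of S] by blast
  moreover obtain c r where "x = (c, r)" by (cases x)
  ultimately have S: "(c, r) \<in> S" and least: "\<And>c' r'. (c', r') \<in> S \<Longrightarrow> r \<le> r'"
    by auto
  have "r \<le> r'" if "A \<subseteq> cball c' r'" for c' r'
    using that S least[of c' r'] by (cases "r' \<le> D") (auto simp: mem_S)
  then have "is_MEB A c r"
    using S by (simp add: is_MEB_def mem_S)
  then show ?thesis by blast
qed

lemma Rad_eq: "is_MEB A c r \<Longrightarrow> Rad A = r"
  unfolding Rad_def is_MEB_def by (blast intro: order_antisym)

lemma is_MEB_Rad:
  fixes A :: "'a::heine_borel set"
  assumes "bounded A" "A \<noteq> {}"
  shows "\<exists>c. is_MEB A c (Rad A)"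
  using is_MEB_exists[OF assms] Rad_eq by blast

lemma Rad_le:
  fixes A :: "'a::heine_borel set"
  assumes "A \<subseteq> cball c r" "A \<noteq> {}"
  shows "Rad A \<le> r"
  using is_MEB_Rad[of A] bounded_subset[OF bounded_cball assms(1)] assms
  unfolding is_MEB_def by blast

lemma Rad_nonneg:
  fixes A :: "'a::heine_borel set"
  assumes "bounded A" "A \<noteq> {}"
  shows "0 \<le> Rad A"
  using is_MEB_Rad[OF assms] radius_nonneg_if_subset_cball[OF _ assms(2)]
  unfolding is_MEB_def by blast

lemma Rad_mono:
  fixes A B :: "'a::heine_borel set"
  assumes "bounded B" "A \<subseteq> B" "A \<noteq> {}"
  shows "Rad A \<le> Rad B"
proof -
  obtain c where "B \<subseteq> cball c (Rad B)"
    using is_MEB_Rad[OF assms(1)] assms(2,3) unfolding is_MEB_def by blast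
  then show ?thesis using assms(2,3) by (intro Rad_le) auto
qed

lemma is_MEB_MEB_center:
  fixes A :: "'a::euclidean_space set"
  assumes "bounded A" "A \<noteq> {}"
  shows "is_MEB A (MEB_center A) (Rad A)"
proof -
  obtain c where c: "is_MEB A c (Rad A)" using is_MEB_Rad[OF assms] by blast
  have "c' = c" if "is_MEB A c' (Rad A)" for c'
    using is_MEB_power2_dist_center_le[OF c assms(2), of c' "Rad A"] that
    unfolding is_MEB_def by auto
  with c show ?thesis unfolding MEB_center_def by (rule theI)
qed

lemma dist_MEB_center_le_Rad:
  fixes A :: "'a::euclidean_space set"
  assumes "bounded A" "x \<in> A"
  shows "dist x (MEB_center A) \<le> Rad A"
proof -
  have "is_MEB A (MEB_center A) (Rad A)"
    using assms by (intro is_MEB_MEB_center) auto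
  then show ?thesis
    using assms(2) unfolding is_MEB_def by (auto simp: dist_commute)
qed

lemma Rad_power2_dist_MEB_center_le:
  fixes A B :: "'a::euclidean_space set"
  assumes "bounded B" "A \<subseteq> B" "A \<noteq> {}"
  shows "(Rad A)\<^sup>2 + (dist (MEB_center A) (MEB_center B))\<^sup>2 \<le> (Rad B)\<^sup>2"
proof (rule is_MEB_power2_dist_center_le[OF is_MEB_MEB_center])
  show "bounded A" using assms(1,2) by (rule bounded_subset)
  show "A \<subseteq> cball (MEB_center B) (Rad B)"
    using is_MEB_MEB_center[OF assms(1)] assms(2,3) unfolding is_MEB_def by blast
qed (use assms in auto)

text \<open>A step of the recursion of Badoiu and Clarkson, which preserves \<open>r / M \<ge> j / (j + 2)\<close>;
  \<open>K\<close> is the distance by which the center moves.\<close>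

lemma radius_ratio_step:
  fixes r r' K D M j :: real
  assumes nonneg: "0 \<le> r'" "0 \<le> M" "0 \<le> j" and "M < D"
    and pythagoras: "r\<^sup>2 + K\<^sup>2 \<le> r'\<^sup>2" and triangle: "D - K \<le> r'" and ratio: "M * j \<le> r * (j + 2)"
  shows "M * (j + 1) < r' * (j + 3)"
proof (rule ccontr)
  assume "\<not> ?thesis"
  then have r'_le: "r' \<le> M * (j + 1) / (j + 3)" using nonneg by (simp add: field_simps)
  have "M * 2 / (j + 3) = M - M * (j + 1) / (j + 3)" using nonneg by (simp add: field_simps)
  also have "\<dots> < K" using r'_le triangle \<open>M < D\<close> by linarith
  finally have "(M * 2 / (j + 3))\<^sup>2 < K\<^sup>2"
    using nonneg by (intro power_strict_mono) auto
  moreover have "M * j / (j + 2) \<le> r"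
    using ratio nonneg by (simp add: pos_divide_le_eq)
  then have "(M * j / (j + 2))\<^sup>2 \<le> r\<^sup>2"
    using nonneg by (intro power_mono) auto
  moreover have "r'\<^sup>2 \<le> (M * (j + 1) / (j + 3))\<^sup>2"
    using r'_le nonneg by (intro power_mono) auto
  moreover have "(M * (j + 1) / (j + 3))\<^sup>2 \<le> (M * j / (j + 2))\<^sup>2 + (M * 2 / (j + 3))\<^sup>2"
  proof -
    have "(j + 1)\<^sup>2 * (j + 2)\<^sup>2 \<le> j\<^sup>2 * (j + 3)\<^sup>2 + 2\<^sup>2 * (j + 2)\<^sup>2"
      using nonneg by (simp add: power2_eq_square algebra_simps)
    then have "(j + 1)\<^sup>2 * (j + 2)\<^sup>2 / ((j + 2)\<^sup>2 * (j + 3)\<^sup>2)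
        \<le> (j\<^sup>2 * (j + 3)\<^sup>2 + 2\<^sup>2 * (j + 2)\<^sup>2) / ((j + 2)\<^sup>2 * (j + 3)\<^sup>2)"
      by (rule divide_right_mono) simp
    then have "((j + 1) / (j + 3))\<^sup>2 \<le> (j / (j + 2))\<^sup>2 + (2 / (j + 3))\<^sup>2"
      using nonneg by (simp add: power_divide add_divide_distrib[of "_ * _" "_ * _"])
    then have "M\<^sup>2 * ((j + 1) / (j + 3))\<^sup>2 \<le> M\<^sup>2 * ((j / (j + 2))\<^sup>2 + (2 / (j + 3))\<^sup>2)"
      by (intro mult_left_mono) auto
    then show ?thesis
      by (simp add: power_mult_distrib power_divide distrib_left[of "M\<^sup>2"])
  qed
  ultimately show False using pythagoras by linarith
qed

lemma Rad_insert_ratio_step: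
  fixes A :: "'a::euclidean_space set"
  assumes A: "bounded A" "A \<noteq> {}" and "0 \<le> M" "0 \<le> j" "M < dist q (MEB_center A)"
    and "M * j \<le> Rad A * (j + 2)"
  shows "M * (j + 1) < Rad (insert q A) * (j + 3)"
proof (rule radius_ratio_step)
  let ?c = "MEB_center A" and ?c' = "MEB_center (insert q A)"
  have ins: "bounded (insert q A)" using A by simp
  show "0 \<le> Rad (insert q A)" by (rule Rad_nonneg[OF ins]) simp
  show "(Rad A)\<^sup>2 + (dist ?c ?c')\<^sup>2 \<le> (Rad (insert q A))\<^sup>2"
    using ins A by (intro Rad_power2_dist_MEB_center_le) auto
  have "dist q ?c' \<le> Rad (insert q A)" by (rule dist_MEB_center_le_Rad[OF ins]) simp
  then show "dist q ?c - dist ?c ?c' \<le> Rad (insert q A)"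
    using dist_triangle[of q ?c ?c'] by (simp add: dist_commute)
qed fact+

subsection \<open>Order statistics\<close>

lemma nth_rev_sort_iff:
  assumes "mono Q" and t: "t < length xs"
  shows "Q (rev (sort xs) ! t) \<longleftrightarrow> t < length (filter Q xs)"
proof -
  define ys where "ys = rev (sort xs)"
  define I where "I = {i. i < length ys \<and> Q (ys ! i)}"
  have len: "length ys = length xs" and "sorted (rev ys)"
    unfolding ys_def by auto
  then have antimono: "Q (ys ! i)" if "Q (ys ! j)" "i \<le> j" "j < length xs" for i j
    using sorted_rev_nth_mono[of ys i j] that monoD[OF \<open>mono Q\<close>] by auto
  have "length (filter Q ys) = length (filter Q xs)"
    unfolding ys_def by (metis mset_filter mset_rev mset_sort size_mset)
  then have card_I: "card I = length (filter Q xs)"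
    unfolding I_def by (simp add: length_filter_conv_card)
  show ?thesis
  proof (cases "Q (ys ! t)")
    case True
    then have "{..t} \<subseteq> I" unfolding I_def using antimono t len by auto
    then have "card {..t} \<le> card I" unfolding I_def by (intro card_mono) auto
    then show ?thesis using True card_I unfolding ys_def by simp
  next
    case False
    then have "i < t" if "i \<in> I" for i
      using that antimono[of i t] len unfolding I_def by (cases "t \<le> i") auto
    then have "I \<subseteq> {..<t}" by auto
    then have "card I \<le> card {..<t}" by (intro card_mono) auto
    then show ?thesis using False card_I unfolding ys_def by simp
  qed
qed

lemma kth_largest_le:
  assumes "length (filter (\<lambda>x. r < x) xs) \<le> t" "0 \<le> r"
  shows "kth_largest (t + 1) xs \<le> r"
proof (cases "t < length xs")
  case True
  have "mono (\<lambda>x. r < x)" by (auto intro: monoI)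
  from nth_rev_sort_iff[OF this True] show ?thesis
    using assms(1) True by (simp add: kth_largest_def)
qed (use assms in \<open>auto simp: kth_largest_def\<close>)

lemma kth_largest_ge:
  assumes "t < length (filter (\<lambda>x. r \<le> x) xs)"
  shows "r \<le> kth_largest (t + 1) xs"
proof -
  have "t < length xs"
    using assms length_filter_le[of "\<lambda>x. r \<le> x" xs] by linarith
  moreover have "mono (\<lambda>x. r \<le> x)" by (auto intro: monoI)
  ultimately show ?thesis
    using assms nth_rev_sort_iff[of "\<lambda>x. r \<le> x" t xs] by (simp add: kth_largest_def)
qed

subsection \<open>Second moments\<close>

text \<open>Markov's inequality for the square of \<open>X - \<mu> + v / d\<close>: this shift off the mean is the optimal
  one.\<close>

lemma (in prob_space) Cantelli_inequality:
  fixes X :: "'a \<Rightarrow> real"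
  assumes [measurable]: "random_variable borel X" and sq: "integrable M (\<lambda>x. (X x)\<^sup>2)"
    and var: "variance X \<le> v" and d: "0 < d"
  shows "prob {x \<in> space M. expectation X + d \<le> X x} \<le> v / (v + d\<^sup>2)"
proof -
  have int: "integrable M X" using assms(1) sq by (rule square_integrable_imp_integrable)
  have v: "0 \<le> v" using variance_positive[of X] var by linarith
  define \<mu> where "\<mu> = expectation X"
  define c where "c = v / d"
  have c: "0 \<le> c" "c * d = v" unfolding c_def using v d by auto
  have square: "(X x - \<mu> + c)\<^sup>2 = (X x - \<mu>)\<^sup>2 + 2 * c * (X x - \<mu>) + c\<^sup>2" for x
    by (simp add: power2_eq_square algebra_simps)
  have int_square: "integrable M (\<lambda>x. (X x - \<mu>)\<^sup>2)"
    unfolding power2_diff using int sq by auto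
  have "prob {x \<in> space M. \<mu> + d \<le> X x} \<le> prob {x \<in> space M. d + c \<le> \<bar>X x - \<mu> + c\<bar>}"
    using c by (intro finite_measure_mono) auto
  also have "\<dots> \<le> expectation (\<lambda>x. (X x - \<mu> + c)\<^sup>2) / (d + c)\<^sup>2"
    using int int_square c d by (intro second_moment_method) (auto simp: square)
  also have "\<dots> = (variance X + c\<^sup>2) / (d + c)\<^sup>2"
    using int int_square unfolding square by (simp add: prob_space \<mu>_def)
  also have "\<dots> \<le> (v + c\<^sup>2) / (d + c)\<^sup>2"
    using var by (intro divide_right_mono) auto
  also have "\<dots> = v / (v + d\<^sup>2)"
  proof -
    have "v + c\<^sup>2 = c * (d + c)" "v + d\<^sup>2 = d * (d + c)"
      using c by (auto simp: power2_eq_square algebra_simps)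
    moreover have "0 < d + c" using c d by simp
    ultimately show ?thesis using c d by (simp add: power2_eq_square c_def)
  qed
  finally show ?thesis unfolding \<mu>_def .
qed

lemma (in prob_space) Cantelli_inequality_lower:
  fixes X :: "'a \<Rightarrow> real"
  assumes [measurable]: "random_variable borel X" and "integrable M (\<lambda>x. (X x)\<^sup>2)"
    and "variance X \<le> v" "0 < d"
  shows "prob {x \<in> space M. X x \<le> expectation X - d} \<le> v / (v + d\<^sup>2)"
proof -
  have "prob {x \<in> space M. expectation (\<lambda>x. - X x) + d \<le> - X x} \<le> v / (v + d\<^sup>2)"
    using assms by (intro Cantelli_inequality) (auto simp: power2_commute)
  moreover have "expectation (\<lambda>x. - X x) + d \<le> - X x \<longleftrightarrow> X x \<le> expectation X - d" for x
    by auto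
  ultimately show ?thesis by simp
qed

lemma (in prob_space) power2_expectation_le:
  fixes Z :: "'a \<Rightarrow> real"
  assumes [measurable]: "random_variable borel Z" and sq: "integrable M (\<lambda>x. (Z x)\<^sup>2)"
  shows "(expectation Z)\<^sup>2 \<le> expectation (\<lambda>x. (Z x)\<^sup>2) * prob {x \<in> space M. Z x \<noteq> 0}"
proof -
  have int: "integrable M Z" using assms by (rule square_integrable_imp_integrable)
  let ?m = "expectation Z" and ?s = "expectation (\<lambda>x. (Z x)\<^sup>2)"
  have "?m\<^sup>2 \<le> ?s"
    using variance_positive[of Z] variance_eq[OF int sq] by simp
  moreover have "?m\<^sup>2 / ?s \<le> prob {x \<in> space M. Z x \<noteq> 0}"
  proof -
    define l where "l = ?m / ?s"
    have "?m\<^sup>2 / ?s = expectation (\<lambda>x. 2 * l * Z x - l\<^sup>2 * (Z x)\<^sup>2)"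
      using int sq by (simp add: l_def power2_eq_square)
    also have "\<dots> \<le> expectation (indicator {x \<in> space M. Z x \<noteq> 0})"
    proof (rule integral_mono)
      fix x assume "x \<in> space M"
      moreover have "2 * l * Z x - l\<^sup>2 * (Z x)\<^sup>2 \<le> 1"
        using zero_le_power2[of "1 - l * Z x"] by (simp add: power2_eq_square algebra_simps)
      ultimately show "2 * l * Z x - l\<^sup>2 * (Z x)\<^sup>2 \<le> indicator {x \<in> space M. Z x \<noteq> 0} x"
        by (auto simp: indicator_def)
    qed (use int sq in \<open>auto intro!: integrable_real_indicator simp: emeasure_eq_measure\<close>)
    finally show ?thesis by (simp add: Int_def conj_commute)
  qed
  moreover have "0 \<le> ?s" by simp
  ultimately show ?thesis
    by (cases "?s = 0") (simp_all add: pos_divide_le_eq mult.commute)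
qed

subsection \<open>Bernstein polynomials and binomial tails\<close>

lemma pmf_binomial_eq_Bernstein:
  "x \<in> {0..1} \<Longrightarrow> pmf (binomial_pmf n x) k = Bernstein n k x"
  by (simp add: Bernstein_def)

lemma expectation_binomial_eq_sum_Bernstein:
  fixes f :: "nat \<Rightarrow> real"
  assumes "x \<in> {0..1}"
  shows "measure_pmf.expectation (binomial_pmf n x) f = (\<Sum>k\<le>n. f k * Bernstein n k x)"
  using expectation_binomial_pmf'[OF assms, of n f] by (simp add: Bernstein_def mult_ac)

lemma expectation_binomial:
  assumes "x \<in> {0..1}"
  shows "measure_pmf.expectation (binomial_pmf n x) real = n * x"
  by (simp add: expectation_binomial_eq_sum_Bernstein[OF assms])

lemma expectation_binomial_power2:
  assumes "x \<in> {0..1}"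
  shows "measure_pmf.expectation (binomial_pmf n x) (\<lambda>k. (real k)\<^sup>2)
    = n * x + real n * (real n - 1) * x\<^sup>2"
proof -
  have "(\<Sum>k\<le>n. (real k)\<^sup>2 * Bernstein n k x)
      = (\<Sum>k\<le>n. real k * Bernstein n k x + real k * (real k - 1) * Bernstein n k x)"
    by (intro sum.cong) (auto simp: power2_eq_square algebra_simps)
  then show ?thesis
    by (simp only: expectation_binomial_eq_sum_Bernstein[OF assms] sum.distrib
        sum_k_Bernstein sum_kk_Bernstein)
qed

lemma variance_binomial:
  assumes "x \<in> {0..1}"
  shows "measure_pmf.variance (binomial_pmf n x) real = n * x * (1 - x)"
  using assms
  by (subst measure_pmf.variance_eq)
     (simp_all add: expectation_binomial expectation_binomial_power2,
      simp add: power2_eq_square algebra_simps)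

lemma variance_binomial_le:
  "x \<in> {0..1} \<Longrightarrow> measure_pmf.variance (binomial_pmf n x) real \<le> n * x"
  by (simp add: variance_binomial mult_left_le)

lemma Bernstein_Suc_diff:
  fixes x :: real
  assumes "k < n"
  shows "(Bernstein n (Suc k) x - Bernstein n k x) * (Suc k * (1 - x))
    = Bernstein n k x * ((real n + 1) * x - real (Suc k))"
proof -
  have n: "n - k = Suc (n - Suc k)" "real (n - k) = real n - real k" using assms by auto
  have pow: "(1 - x) ^ (n - k) = (1 - x) * (1 - x) ^ (n - Suc k)" by (simp only: n(1) power_Suc)
  have choose: "real (n choose Suc k) * (Suc k) = real (n choose k) * real (n - k)"
    using arg_cong[OF trans[OF binomial_absorption binomial_absorb_comp[symmetric]],
        of real, of k n]
    by (simp only: of_nat_mult mult.commute)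
  have "Bernstein n (Suc k) x * (Suc k * (1 - x)) =
      (real (n choose Suc k) * (Suc k)) * x ^ k * x * ((1 - x) * (1 - x) ^ (n - Suc k))"
    unfolding Bernstein_def by (simp add: algebra_simps)
  also have "\<dots> = Bernstein n k x * ((real n - real k) * x)"
    unfolding choose Bernstein_def pow n(2) by (simp add: algebra_simps)
  finally show ?thesis by (simp add: algebra_simps)
qed

lemma
  fixes x :: real
  assumes "k < n" "0 < x" "x < 1"
  shows Bernstein_le_Suc_iff:
      "Bernstein n k x \<le> Bernstein n (Suc k) x \<longleftrightarrow> real (Suc k) \<le> (real n + 1) * x"
    and Bernstein_Suc_le_iff:
      "Bernstein n (Suc k) x \<le> Bernstein n k x \<longleftrightarrow> (real n + 1) * x \<le> real (Suc k)"
proof -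
  have pos: "0 < Suc k * (1 - x)" "0 < Bernstein n k x"
    using assms by (simp_all add: Bernstein_pos)
  define D u where "D = Bernstein n (Suc k) x - Bernstein n k x"
    and "u = (real n + 1) * x - real (Suc k)"
  have "D * (Suc k * (1 - x)) = Bernstein n k x * u"
    using Bernstein_Suc_diff[OF assms(1)] unfolding D_def u_def by simp
  then have "sgn D = sgn u"
    using pos by (metis mult.commute mult.right_neutral sgn_mult sgn_pos)
  then have "0 \<le> D \<longleftrightarrow> 0 \<le> u" "D \<le> 0 \<longleftrightarrow> u \<le> 0"
    by (auto simp: sgn_if split: if_splits)
  then show "Bernstein n k x \<le> Bernstein n (Suc k) x \<longleftrightarrow> real (Suc k) \<le> (real n + 1) * x"
    and "Bernstein n (Suc k) x \<le> Bernstein n k x \<longleftrightarrow> (real n + 1) * x \<le> real (Suc k)"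
    unfolding D_def u_def by auto
qed

lemma Bernstein_le_mode:
  fixes x :: real
  assumes x: "0 < x" "x < 1" and t: "t \<le> n"
    and mode: "t \<le> (real n + 1) * x" "(real n + 1) * x \<le> t + 1"
  shows "Bernstein n k x \<le> Bernstein n t x"
proof (cases "k \<le> t")
  case True
  then show ?thesis
  proof (induction k rule: inc_induct)
    case (step k)
    have "Bernstein n k x \<le> Bernstein n (Suc k) x"
      using step.hyps t mode x by (subst Bernstein_le_Suc_iff) auto
    then show ?case using step.IH by linarith
  qed simp
next
  case False
  then have "t \<le> k" by simp
  then show ?thesis
  proof (induction k rule: dec_induct)
    case (step k)
    have "Bernstein n (Suc k) x \<le> Bernstein n k x"
    proof (cases "k < n")
      case True
      then show ?thesis using step.hyps mode x by (subst Bernstein_Suc_le_iff) auto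
    next
      case False
      then have "Bernstein n (Suc k) x = 0" unfolding Bernstein_def by simp
      then show ?thesis using x by (simp add: Bernstein_nonneg)
    qed
    then show ?case using step.IH by linarith
  qed simp
qed

lemma
  fixes m w :: real
  shows finite_nat_near: "finite {k::nat. \<bar>real k - m\<bar> < w}"
    and card_nat_near_le: "0 \<le> w \<Longrightarrow> real (card {k::nat. \<bar>real k - m\<bar> < w}) \<le> 2 * w + 1"
proof -
  let ?A = "{k::nat. \<bar>real k - m\<bar> < w}"
  have sub: "int ` ?A \<subseteq> {\<lceil>m - w\<rceil>..\<lfloor>m + w\<rfloor>}"
    by (auto simp: ceiling_le_iff le_floor_iff)
  then have "finite (int ` ?A)" by (rule finite_subset) simp
  then show "finite ?A" by (rule finite_imageD) simp
  have "card (int ` ?A) \<le> card {\<lceil>m - w\<rceil>..\<lfloor>m + w\<rfloor>}"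
    using sub by (intro card_mono) auto
  then have "card ?A \<le> nat (\<lfloor>m + w\<rfloor> + 1 - \<lceil>m - w\<rceil>)"
    by (simp add: card_image)
  moreover have "real_of_int (\<lfloor>m + w\<rfloor> + 1 - \<lceil>m - w\<rceil>) \<le> 2 * w + 1" by linarith
  ultimately show "real (card ?A) \<le> 2 * w + 1" if "0 \<le> w" using that by linarith
qed

text \<open>By Chebyshev, half of the mass lies within \<open>2 \<surd>t\<close> of the mean, and none of the at most
  \<open>5 \<surd>t\<close> integers there has more mass than the mode.\<close>

lemma Bernstein_mode_ge:
  fixes x :: real
  assumes x: "0 < x" "x < 1" and t: "1 \<le> t" "t \<le> n"
    and mode: "t \<le> (real n + 1) * x" "(real n + 1) * x \<le> t + 1"
  shows "1 / (10 * sqrt t) \<le> Bernstein n t x"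
proof -
  define w where "w = 2 * sqrt t"
  define A where "A = {k::nat. \<bar>real k - n * x\<bar> < w}"
  let ?B = "measure_pmf.prob (binomial_pmf n x)"
    and ?E = "measure_pmf.expectation (binomial_pmf n x)"
  have x_mem: "x \<in> {0..1}" using x by simp
  have w: "0 < w" "w\<^sup>2 = 4 * t" unfolding w_def using t by (auto simp: power_mult_distrib)
  have "UNIV - A = {k \<in> space (binomial_pmf n x). w \<le> \<bar>real k - ?E real\<bar>}"
    unfolding A_def expectation_binomial[OF x_mem] by auto
  then have "?B (UNIV - A) \<le> measure_pmf.variance (binomial_pmf n x) real / w\<^sup>2"
    using x_mem w(1) by (simp only:) (intro measure_pmf.Chebyshev_inequality, auto)
  also have "\<dots> \<le> n * x / w\<^sup>2"
    by (intro divide_right_mono variance_binomial_le x_mem) simp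
  also have "\<dots> \<le> 2 * t / w\<^sup>2"
    using mode(2) x t by (intro divide_right_mono) (auto simp: algebra_simps)
  also have "\<dots> = 1 / 2"
    using t unfolding w by simp
  finally have "?B (UNIV - A) \<le> 1 / 2" .
  then have "1 / 2 \<le> ?B A"
    using measure_pmf.prob_compl[of A "binomial_pmf n x"] by simp
  also have "\<dots> = (\<Sum>k\<in>A. Bernstein n k x)"
    unfolding A_def using finite_nat_near x_mem
    by (simp add: measure_measure_pmf_finite pmf_binomial_eq_Bernstein del: pmf_binomial)
  also have "\<dots> \<le> real (card A) * Bernstein n t x"
    using Bernstein_le_mode[OF x t(2) mode] by (intro sum_bounded_above)
  also have "\<dots> \<le> (2 * w + 1) * Bernstein n t x"
    unfolding A_def using x w
    by (intro mult_right_mono card_nat_near_le Bernstein_nonneg) auto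
  also have "\<dots> \<le> 5 * sqrt t * Bernstein n t x"
    unfolding w_def using t x by (intro mult_right_mono Bernstein_nonneg) auto
  finally show ?thesis using t by (simp add: field_simps)
qed

definition binomial_tail :: "nat \<Rightarrow> nat \<Rightarrow> real \<Rightarrow> real" where
  "binomial_tail n t x = (\<Sum>k\<in>{t<..n}. Bernstein n k x)"

lemma prob_binomial_greaterThan:
  assumes "x \<in> {0..1}"
  shows "measure_pmf.prob (binomial_pmf n x) {t<..} = binomial_tail n t x"
proof -
  have "measure_pmf.prob (binomial_pmf n x) {t<..} = measure_pmf.prob (binomial_pmf n x) {t<..n}"
    using assms by (intro measure_prob_cong_0) (auto simp: binomial_eq_0)
  also have "\<dots> = binomial_tail n t x"
    unfolding binomial_tail_def using assms
    by (simp add: measure_measure_pmf_finite pmf_binomial_eq_Bernstein del: pmf_binomial)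
  finally show ?thesis .
qed

lemma Bernstein_Suc_has_real_derivative:
  assumes "k \<le> n"
  shows "(Bernstein (Suc n) (Suc k) has_real_derivative
     Suc n * (Bernstein n k x - Bernstein n (Suc k) x)) (at x)"
proof -
  have choose_Suc: "real (Suc n choose Suc k) * (Suc k) = Suc n * real (n choose k)"
    using arg_cong[OF Suc_times_binomial_eq, of real, of n k]
    by (simp only: of_nat_mult mult.commute)
  have choose_comp: "real (Suc n choose Suc k) * (n - k) = Suc n * real (n choose Suc k)"
    using arg_cong[OF binomial_absorb_comp, of real, of "Suc n" "Suc k"]
    by (simp only: of_nat_mult mult.commute diff_Suc_Suc diff_Suc_1)
  have "((\<lambda>x. (1 - x) ^ (n - k)) has_real_derivative - ((n - k) * (1 - x) ^ (n - k - 1))) (at x)"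
    by (auto intro!: derivative_eq_intros)
  note DERIV_mult[OF DERIV_cmult[OF DERIV_pow[of "Suc k" x]] this, of "real (Suc n choose Suc k)"]
  then have "(Bernstein (Suc n) (Suc k) has_real_derivative
      (real (Suc n choose Suc k) * (Suc k)) * x ^ k * (1 - x) ^ (n - k)
       - (real (Suc n choose Suc k) * (n - k)) * x ^ Suc k * (1 - x) ^ (n - k - 1)) (at x)"
    unfolding Bernstein_def[abs_def] diff_Suc_Suc
    by (rule DERIV_cong)
       (simp only: algebra_simps diff_Suc_Suc diff_zero mult_minus_right diff_conv_add_uminus)
  then show ?thesis
    unfolding choose_Suc choose_comp
    by (rule DERIV_cong) (simp add: Bernstein_def algebra_simps)
qed

lemma binomial_tail_has_real_derivative:
  assumes "t \<le> n"
  shows "(binomial_tail (Suc n) t has_real_derivative Suc n * Bernstein n t x) (at x)"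
proof -
  have "{t<..Suc n} = Suc ` {t..<Suc n}" by (auto simp: image_Suc_atLeastLessThan)
  then have tail: "binomial_tail (Suc n) t = (\<lambda>x. \<Sum>k\<in>{t..<Suc n}. Bernstein (Suc n) (Suc k) x)"
    unfolding binomial_tail_def[abs_def]
    by (simp only: sum.reindex[OF inj_on_subset[OF inj_Suc subset_UNIV]] o_def)
  have "((\<lambda>x. \<Sum>k\<in>{t..<Suc n}. Bernstein (Suc n) (Suc k) x) has_real_derivative
     (\<Sum>k\<in>{t..<Suc n}. Suc n * (Bernstein n k x - Bernstein n (Suc k) x))) (at x)"
    by (intro DERIV_sum Bernstein_Suc_has_real_derivative) auto
  moreover have "(\<Sum>k\<in>{t..<Suc n}. Bernstein n k x - Bernstein n (Suc k) x) = Bernstein n t x"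
    using assms sum_Suc_diff'[of t "Suc n" "\<lambda>k. - Bernstein n k x"] Bernstein_def[of n "Suc n" x]
    by (simp del: sum.op_ivl_Suc)
  ultimately show ?thesis
    unfolding tail sum_distrib_left[symmetric] by (simp only:)
qed

lemma binomial_tail_mono:
  fixes x y :: real
  assumes "0 \<le> x" "x \<le> y" "y \<le> 1"
  shows "binomial_tail n t x \<le> binomial_tail n t y"
proof (cases "t < n")
  case True
  then obtain n' where n: "n = Suc n'" "t \<le> n'" by (cases n) auto
  show ?thesis
    unfolding n(1) using assms n(2)
    by (intro DERIV_nonneg_imp_nondecreasing[OF assms(2)])
       (auto intro!: binomial_tail_has_real_derivative mult_nonneg_nonneg Bernstein_nonneg exI)
qed (simp add: binomial_tail_def)

text \<open>The derivative of the tail is a binomial point mass, and for arguments between \<open>t / n\<close> and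
  \<open>(t + 1) / n\<close> it is the mode.\<close>

lemma binomial_tail_diff_ge:
  fixes d x y :: real
  assumes x: "0 \<le> x" "n * x \<le> t" and y: "y \<le> 1" "t + d \<le> n * y" and t: "1 \<le> t" and d: "0 < d"
  shows "min d 1 / (10 * sqrt t) \<le> binomial_tail n t y - binomial_tail n t x"
proof -
  have "n * y \<le> n" using mult_left_mono[OF y(1), of "real n"] by simp
  then have "t < n" using y(2) d by linarith
  then obtain n' where n: "n = Suc n'" "t \<le> n'" by (cases n) auto
  define u v where "u = t / n" and "v = (t + min d 1) / n"
  have nu: "n * u = t" and nv: "n * v = t + min d 1" unfolding u_def v_def n by simp_all
  have "n * x \<le> n * u" "n * u < n * v" "n * v \<le> n * y" unfolding nu nv using x y d by auto
  then have xu: "x \<le> u" and uv: "u < v" and vy: "v \<le> y" unfolding n by simp_all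
  have u: "0 < u" unfolding u_def using t n by simp
  obtain w where w: "u < w" "w < v"
    "binomial_tail n t v - binomial_tail n t u = (v - u) * (n * Bernstein n' t w)"
    using MVT2[OF uv binomial_tail_has_real_derivative[OF n(2)]] unfolding n(1) by metis
  have "n * u \<le> n * w" "n * w \<le> n * v" using w by (auto intro!: mult_left_mono)
  then have "t \<le> (real n' + 1) * w" "(real n' + 1) * w \<le> t + 1"
    using nu nv by (auto simp: n(1) algebra_simps)
  then have "1 / (10 * sqrt t) \<le> Bernstein n' t w"
    using t n(2) u w vy y(1) by (intro Bernstein_mode_ge) auto
  then have "(n * v - n * u) * (1 / (10 * sqrt t)) \<le> (n * v - n * u) * Bernstein n' t w"
    using nu nv d by (intro mult_left_mono) auto
  also have "\<dots> = binomial_tail n t v - binomial_tail n t u"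
    unfolding w(3) by (simp add: algebra_simps)
  also have "\<dots> \<le> binomial_tail n t y - binomial_tail n t x"
    using x u xu vy y uv by (intro diff_mono binomial_tail_mono) auto
  finally show ?thesis unfolding nu nv by simp
qed

lemma binomial_tail_le:
  fixes m x :: real
  assumes x: "x \<in> {0..1}" and m: "n * x \<le> m" "m < t"
  shows "binomial_tail n t x \<le> m / (m + (t - m)\<^sup>2)"
proof -
  have "0 \<le> n * x" using x by simp
  then have m0: "0 \<le> m" using m(1) by linarith
  show ?thesis
  proof (cases "t < n")
    case True
    define y where "y = m / n"
    have y: "y \<in> {0..1}" "n * y = m" "x \<le> y"
      unfolding y_def using m m0 True x by (auto simp: field_simps)
    have "binomial_tail n t x \<le> binomial_tail n t y"
      using x y by (intro binomial_tail_mono) auto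
    also have "\<dots> \<le> measure_pmf.prob (binomial_pmf n y) {k. m + (t - m) \<le> real k}"
      unfolding prob_binomial_greaterThan[OF y(1), symmetric]
      by (intro measure_pmf.finite_measure_mono) auto
    also have "\<dots> \<le> m / (m + (t - m)\<^sup>2)"
      using measure_pmf.Cantelli_inequality[OF _ _ variance_binomial_le[OF y(1), of n], of "t - m"]
        m(2) y
      by (simp add: expectation_binomial)
    finally show ?thesis .
  qed (simp add: binomial_tail_def m0)
qed

lemma binomial_tail_ge:
  fixes m x :: real
  assumes x: "x \<le> 1" and m: "m \<le> n * x" "t < m"
  shows "1 - m / (m + (m - t)\<^sup>2) \<le> binomial_tail n t x"
proof -
  have m0: "0 < m" using m(2) by linarith
  have "n * x \<le> n" using mult_left_mono[OF x, of "real n"] by simp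
  then have n: "0 < real n" "m \<le> n" using m m0 by auto
  define y where "y = m / n"
  have y: "y \<in> {0..1}" "n * y = m" "y \<le> x"
    unfolding y_def using m n m0 by (auto simp: field_simps)
  let ?B = "measure_pmf.prob (binomial_pmf n y)"
  have "?B {k. real k \<le> t} \<le> m / (m + (m - t)\<^sup>2)"
    using measure_pmf.Cantelli_inequality_lower[OF _ _ variance_binomial_le[OF y(1), of n],
        of "m - t"] m(2) y
    by (simp add: expectation_binomial)
  moreover have "?B {k. real k \<le> t} = 1 - binomial_tail n t y"
    unfolding prob_binomial_greaterThan[OF y(1), symmetric]
    by (subst measure_pmf.prob_compl[symmetric]) (auto intro!: arg_cong[of _ _ ?B])
  moreover have "binomial_tail n t y \<le> binomial_tail n t x"
    using x y by (intro binomial_tail_mono) auto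
  ultimately show ?thesis by linarith
qed

lemma divide_add_le_inverse:
  fixes c d m :: real
  assumes "0 < m" "0 \<le> c" "c * m \<le> d"
  shows "m / (m + d) \<le> 1 / (1 + c)"
proof -
  have "m * (1 + c) \<le> m + d" using assms(3) by (simp add: algebra_simps)
  moreover have "0 < m * (1 + c)" using assms(1,2) by (intro mult_pos_pos) auto
  ultimately have "m / (m + d) \<le> m / (m * (1 + c))"
    using assms(1) by (intro frac_le) auto
  also have "\<dots> = 1 / (1 + c)" using assms by simp
  finally show ?thesis .
qed

lemma inverse_one_plus_le:
  fixes c K :: real
  assumes "0 \<le> c" "c \<le> K"
  shows "1 / (1 + c) \<le> 1 - c / (1 + K)"
proof -
  have "1 / (1 + c) = 1 - c / (1 + c)" using assms by (simp add: field_simps)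
  also have "\<dots> \<le> 1 - c / (1 + K)"
    using assms by (intro diff_left_mono divide_left_mono) auto
  finally show ?thesis .
qed

context
  fixes a \<mu> :: real and t :: nat
  assumes a: "0 < a" "a < 1 / 15" and mu: "0 < \<mu>" and t: "real t = (1 + a)\<^sup>2 * \<mu>"
begin

lemma binomial_tail_le_if_mean_le:
  assumes x: "x \<in> {0..1}" and mean: "n * x \<le> (1 + a) * \<mu>"
  shows "binomial_tail n t x \<le> 1 / (1 + a\<^sup>2 * \<mu>)"
proof -
  define m where "m = (1 + a) * \<mu>"
  have gap: "t - m = a * (1 + a) * \<mu>"
    unfolding m_def t by (simp add: power2_eq_square algebra_simps)
  have "0 < a * (1 + a) * \<mu>" using a mu by simp
  then have "m < t" using gap by linarith
  moreover have "0 < m" unfolding m_def using a mu by simp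
  ultimately have m: "0 < m" "m < t" by auto
  have "a\<^sup>2 * \<mu> * m * 1 \<le> a\<^sup>2 * \<mu> * m * (1 + a)"
    using a mu m by (intro mult_left_mono) auto
  then have "a\<^sup>2 * \<mu> * m \<le> (t - m)\<^sup>2"
    unfolding gap unfolding m_def by (simp add: power2_eq_square algebra_simps)
  then have "m / (m + (t - m)\<^sup>2) \<le> 1 / (1 + a\<^sup>2 * \<mu>)"
    using m(1) mu by (intro divide_add_le_inverse) auto
  then show ?thesis
    using binomial_tail_le[OF x _ m(2), of n] mean unfolding m_def by linarith
qed

lemma binomial_tail_ge_if_mean_ge:
  assumes y: "y \<le> 1" and mean: "(1 + 5 * a) * \<mu> \<le> n * y"
  shows "1 - 1 / (1 + 6 * (a\<^sup>2 * \<mu>)) \<le> binomial_tail n t y"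
proof -
  define m where "m = (1 + 5 * a) * \<mu>"
  have gap: "m - t = a * (3 - a) * \<mu>"
    unfolding m_def t by (simp add: power2_eq_square algebra_simps)
  have "0 < a * (3 - a) * \<mu>" using a mu by simp
  then have "t < m" using gap by linarith
  moreover have "0 < m" unfolding m_def using a mu by simp
  ultimately have m: "0 < m" "t < m" by auto
  have "6 * (1 + 5 * a) \<le> (3 - a)\<^sup>2"
  proof -
    have "6 * (1 + 5 * a) \<le> (3 - 1 / 15)\<^sup>2" using a by (simp add: power2_eq_square)
    also have "\<dots> \<le> (3 - a)\<^sup>2" using a by (intro power_mono) auto
    finally show ?thesis .
  qed
  then have "(a * \<mu>)\<^sup>2 * (6 * (1 + 5 * a)) \<le> (a * \<mu>)\<^sup>2 * (3 - a)\<^sup>2"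
    by (intro mult_left_mono) auto
  then have "6 * (a\<^sup>2 * \<mu>) * m \<le> (m - t)\<^sup>2"
    unfolding gap unfolding m_def by (simp add: power2_eq_square mult_ac)
  then have "m / (m + (m - t)\<^sup>2) \<le> 1 / (1 + 6 * (a\<^sup>2 * \<mu>))"
    using m(1) mu by (intro divide_add_le_inverse) auto
  then show ?thesis
    using binomial_tail_ge[OF y _ m(2), of n] mean unfolding m_def by linarith
qed

lemma binomial_tail_ge_confidence:
  assumes "y \<le> 1" "(1 + 5 * a) * \<mu> \<le> n * y" and e: "e \<le> 1" "e \<le> a\<^sup>2 * \<mu> / 40"
  shows "12 / 13 * e \<le> binomial_tail n t y"
proof -
  define Y where "Y = a\<^sup>2 * \<mu>"
  have Y: "0 \<le> Y" unfolding Y_def using mu by simp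
  have "12 / 13 * e \<le> 1 - 1 / (1 + 6 * Y)"
  proof (cases "2 \<le> Y")
    case True
    then have "1 / (1 + 6 * Y) \<le> 1 / 13" by (intro divide_left_mono) auto
    then show ?thesis using e by linarith
  next
    case False
    then have "1 / (1 + 6 * Y) \<le> 1 - 6 * Y / 13"
      using inverse_one_plus_le[of "6 * Y" 12] Y by simp
    then show ?thesis using e(2) Y unfolding Y_def[symmetric] by linarith
  qed
  then show ?thesis
    using binomial_tail_ge_if_mean_ge[OF assms(1,2)] unfolding Y_def by linarith
qed

lemma one_minus_binomial_tail_ge_confidence:
  assumes "x \<in> {0..1}" "n * x \<le> (1 + a) * \<mu>" and e: "0 \<le> e" "e \<le> 1" "e \<le> a\<^sup>2 * \<mu> / 40"
  shows "e * (a / (3 * (1 + a))) \<le> 1 - binomial_tail n t x"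
proof -
  define Y where "Y = a\<^sup>2 * \<mu>"
  have Y: "0 \<le> Y" unfolding Y_def using mu by simp
  have "a / (3 * (1 + a)) \<le> 1 / 3" using a by (simp add: field_simps)
  then have "e * (a / (3 * (1 + a))) \<le> e * (1 / 3)" using e by (intro mult_left_mono)
  also have "\<dots> \<le> 1 - 1 / (1 + Y)"
  proof (cases "1 \<le> Y")
    case True
    then have "1 / (1 + Y) \<le> 1 / 2" by (intro divide_left_mono) auto
    then show ?thesis using e by linarith
  next
    case False
    then have "1 / (1 + Y) \<le> 1 - Y / 2"
      using inverse_one_plus_le[of Y 1] Y by simp
    then show ?thesis using e(3) Y unfolding Y_def[symmetric] by linarith
  qed
  finally show ?thesis
    using binomial_tail_le_if_mean_le[OF assms(1,2)] unfolding Y_def by linarith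
qed

lemma binomial_tail_diff_ge_small:
  assumes x: "0 \<le> x" "n * x \<le> (1 + a) * \<mu>" and y: "y \<le> 1" "(1 + 5 * a) * \<mu> \<le> n * y"
    and small: "a\<^sup>2 * \<mu> \<le> 4"
  shows "a / 30 \<le> binomial_tail n t y - binomial_tail n t x"
proof -
  define d where "d = a * (3 - a) * \<mu>"
  have d: "0 < d" unfolding d_def using a mu by simp
  have "(1 + a) * \<mu> \<le> t" unfolding t using a mu by (simp add: power2_eq_square)
  then have n_x: "n * x \<le> t" using x(2) by linarith
  have "t + d = (1 + 5 * a) * \<mu>"
    unfolding d_def t by (simp add: power2_eq_square algebra_simps)
  then have n_y: "t + d \<le> n * y" using y(2) by linarith
  have "0 < real t" unfolding t using a mu by simp
  then have "1 \<le> t" by simp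
  define w where "w = sqrt t"
  have w: "1 \<le> w" "w\<^sup>2 = t" unfolding w_def using \<open>1 \<le> t\<close> by auto
  have "(1 + a)\<^sup>2 \<le> (1 + 1 / 15)\<^sup>2" using a by (intro power_mono) auto
  then have square: "(1 + a)\<^sup>2 \<le> 2" by (simp add: power2_eq_square)
  have "a * w \<le> 3 * d"
  proof -
    have "w \<le> w\<^sup>2" using w(1) by (simp add: power2_eq_square)
    also have "\<dots> \<le> 2 * \<mu>" unfolding w(2) t using square mu by (intro mult_right_mono) auto
    also have "\<dots> \<le> 3 * ((3 - a) * \<mu>)" using a mu by simp
    finally have "a * w \<le> a * (3 * ((3 - a) * \<mu>))" using a by (intro mult_left_mono) auto
    then show ?thesis unfolding d_def by (simp add: mult_ac)
  qed
  moreover have "a * w \<le> 3"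
  proof (rule power2_le_imp_le)
    have "(a * w)\<^sup>2 = (1 + a)\<^sup>2 * (a\<^sup>2 * \<mu>)"
      unfolding power_mult_distrib w(2) t by (simp add: mult_ac)
    also have "\<dots> \<le> 2 * 4" using square small mu by (intro mult_mono) auto
    finally show "(a * w)\<^sup>2 \<le> 3\<^sup>2" by simp
  qed simp
  ultimately have "a * w / 3 / (10 * w) \<le> min d 1 / (10 * w)"
    using w(1) by (intro divide_right_mono) auto
  also have "\<dots> \<le> binomial_tail n t y - binomial_tail n t x"
    unfolding w_def by (rule binomial_tail_diff_ge[OF x(1) n_x y(1) n_y \<open>1 \<le> t\<close> d])
  finally show ?thesis using w(1) by simp
qed

lemma binomial_tail_diff_ge_confidence:
  assumes x: "0 \<le> x" "n * x \<le> (1 + a) * \<mu>" and y: "y \<le> 1" "(1 + 5 * a) * \<mu> \<le> n * y"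
    and e: "0 \<le> e" "e \<le> 1" "e \<le> a\<^sup>2 * \<mu> / 40"
  shows "e * (a / (3 * (1 + a))) \<le> binomial_tail n t y - binomial_tail n t x"
proof -
  define Y where "Y = a\<^sup>2 * \<mu>"
  have "a / (3 * (1 + a)) \<le> a / 3" using a by (intro divide_left_mono) auto
  then have "e * (a / (3 * (1 + a))) \<le> e * (a / 3)"
    using e(1) by (rule mult_left_mono)
  also have "\<dots> \<le> binomial_tail n t y - binomial_tail n t x"
  proof (cases "Y \<le> 4")
    case True
    then have "e \<le> 1 / 10" using e(3) unfolding Y_def by linarith
    then have "e * (a / 3) \<le> 1 / 10 * (a / 3)" using a by (intro mult_right_mono) auto
    also have "\<dots> \<le> binomial_tail n t y - binomial_tail n t x"
      using binomial_tail_diff_ge_small[OF x y] True unfolding Y_def by simp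
    finally show ?thesis .
  next
    case False
    then have "1 / (1 + Y) \<le> 1 / 5" "1 / (1 + 6 * Y) \<le> 1 / 25"
      by (auto intro!: divide_left_mono)
    moreover have "x \<in> {0..1}"
    proof -
      have pos: "0 < (1 + 5 * a) * \<mu>" using a mu by simp
      have "(1 + a) * \<mu> \<le> (1 + 5 * a) * \<mu>" using a mu by (intro mult_right_mono) auto
      then have "n * x \<le> n * y" using x y by linarith
      moreover have "0 < real n" using pos y(2) by (cases "n = 0") auto
      ultimately have "x \<le> y" by simp
      then show ?thesis using x y by simp
    qed
    ultimately have "1 / 2 \<le> binomial_tail n t y - binomial_tail n t x"
      using binomial_tail_le_if_mean_le[OF _ x(2)] binomial_tail_ge_if_mean_ge[OF y]
      unfolding Y_def by auto
    moreover have "e * (a / 3) \<le> 1 * (1 / 2)" using e a by (intro mult_mono) auto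
    ultimately show ?thesis by linarith
  qed
  finally show ?thesis .
qed

end

subsection \<open>Independent samples\<close>

lemma prob_bind_pmf:
  fixes f :: "'a \<Rightarrow> 'b pmf"
  shows "measure_pmf.prob (bind_pmf p f) S
    = measure_pmf.expectation p (\<lambda>x. measure_pmf.prob (f x) S)"
proof -
  have "measure_pmf.prob q S = pmf (map_pmf (\<lambda>x. x \<in> S) q) True" for q
    by (simp add: pmf_map vimage_def)
  then show ?thesis by (simp add: map_bind_pmf pmf_bind)
qed

lemma prob_bind_pmf_ge:
  assumes "0 \<le> c" and "\<And>x. x \<in> set_pmf p \<Longrightarrow> x \<in> S \<Longrightarrow> c \<le> measure_pmf.prob (f x) E"
  shows "measure_pmf.prob p S * c \<le> measure_pmf.prob (bind_pmf p f) E"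
proof -
  have "measure_pmf.prob p S * c = measure_pmf.expectation p (\<lambda>x. indicator S x * c)" by simp
  also have "\<dots> \<le> measure_pmf.expectation p (\<lambda>x. measure_pmf.prob (f x) E)"
  proof (rule integral_mono_AE)
    show "integrable p (\<lambda>x. measure_pmf.prob (f x) E)"
      by (rule measure_pmf.integrable_const_bound[of _ 1]) auto
    show "AE x in p. indicator S x * c \<le> measure_pmf.prob (f x) E"
      using assms(2) by (auto simp: AE_measure_pmf_iff indicator_def)
  qed (auto intro!: integrable_real_indicator simp: measure_pmf.emeasure_eq_measure)
  finally show ?thesis by (simp add: prob_bind_pmf)
qed

definition hits :: "'a set \<Rightarrow> 'a list \<Rightarrow> nat" where
  "hits S xs = length (filter (\<lambda>x. x \<in> S) xs)"

lemma hits_Nil [simp]: "hits S [] = 0"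
  and hits_Cons [simp]: "hits S (x # xs) = (if x \<in> S then 1 else 0) + hits S xs"
  unfolding hits_def by auto

lemma hits_eq_size_filter_mset: "hits S xs = size (filter_mset (\<lambda>x. x \<in> S) (mset xs))"
  unfolding hits_def by (metis mset_filter size_mset)

lemma hits_mono: "S \<subseteq> S' \<Longrightarrow> hits S xs \<le> hits S' xs"
  by (induction xs) auto

lemma hits_Un_disjoint: "S \<inter> S' = {} \<Longrightarrow> hits (S \<union> S') xs = hits S xs + hits S' xs"
  by (induction xs) auto

lemma map_pmf_mem_eq_bernoulli:
  "map_pmf (\<lambda>x. x \<in> S) p = bernoulli_pmf (measure_pmf.prob p S)"
proof (rule pmf_eqI)
  fix b
  show "pmf (map_pmf (\<lambda>x. x \<in> S) p) b = pmf (bernoulli_pmf (measure_pmf.prob p S)) b"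
    using measure_pmf.prob_compl[of S p]
    by (cases b) (auto simp: pmf_map vimage_def Compl_eq_Diff_UNIV[symmetric] Collect_neg_eq)
qed

lemma map_pmf_hits_eq_binomial:
  "map_pmf (hits S) (replicate_pmf n p) = binomial_pmf n (measure_pmf.prob p S)"
proof (induction n)
  case (Suc n)
  have "map_pmf (hits S) (replicate_pmf (Suc n) p)
      = bind_pmf (map_pmf (\<lambda>x. x \<in> S) p) (\<lambda>b. bind_pmf (map_pmf (hits S) (replicate_pmf n p))
          (\<lambda>k. return_pmf ((if b then 1 else 0) + k)))"
    by (simp add: map_bind_pmf bind_map_pmf)
  then show ?case
    by (simp add: Suc map_pmf_mem_eq_bernoulli binomial_pmf_Suc)
qed (simp add: binomial_pmf_0)

lemma expectation_hits_eq_binomial: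
  fixes f :: "nat \<Rightarrow> real"
  shows "measure_pmf.expectation (replicate_pmf n p) (\<lambda>xs. f (hits S xs))
    = measure_pmf.expectation (binomial_pmf n (measure_pmf.prob p S)) f"
  by (simp flip: map_pmf_hits_eq_binomial)

lemma expectation_hits:
  "measure_pmf.expectation (replicate_pmf n p) (\<lambda>xs. real (hits S xs)) = n * measure_pmf.prob p S"
  by (simp add: expectation_hits_eq_binomial expectation_binomial)

lemma expectation_hits_power2:
  "measure_pmf.expectation (replicate_pmf n p) (\<lambda>xs. (real (hits S xs))\<^sup>2)
    = n * measure_pmf.prob p S + real n * (real n - 1) * (measure_pmf.prob p S)\<^sup>2"
  by (simp add: expectation_hits_eq_binomial[where f = "\<lambda>k. (real k)\<^sup>2"]
      expectation_binomial_power2)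

lemma expectation_hits_power2_le:
  "measure_pmf.expectation (replicate_pmf n p) (\<lambda>xs. (real (hits S xs))\<^sup>2)
    \<le> n * measure_pmf.prob p S * (1 + n * measure_pmf.prob p S)"
  unfolding expectation_hits_power2 by (simp add: algebra_simps power2_eq_square)

lemma integrable_hits2:
  fixes f :: "nat \<Rightarrow> nat \<Rightarrow> real"
  shows "integrable (replicate_pmf n p) (\<lambda>xs. f (hits S xs) (hits S' xs))"
proof -
  let ?h = "\<lambda>xs. (hits S xs, hits S' xs)"
  have "?h ` set_pmf (replicate_pmf n p) \<subseteq> {..n} \<times> {..n}"
    by (auto simp: set_replicate_pmf hits_def)
  then have "finite (set_pmf (map_pmf ?h (replicate_pmf n p)))"
    by (simp add: finite_subset)
  then have "integrable (map_pmf ?h (replicate_pmf n p)) (case_prod f)"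
    by (rule integrable_measure_pmf_finite)
  then show ?thesis by simp
qed

lemmas integrable_hits = integrable_hits2[where f = "\<lambda>i _. f i" for f :: "nat \<Rightarrow> real"]

lemma expectation_hits_mult_disjoint:
  assumes "S \<inter> S' = {}"
  shows "measure_pmf.expectation (replicate_pmf n p) (\<lambda>xs. real (hits S xs) * real (hits S' xs))
    = real n * (real n - 1) * (measure_pmf.prob p S * measure_pmf.prob p S')"
proof -
  let ?E = "measure_pmf.expectation (replicate_pmf n p)"
  have "2 * (real (hits S xs) * real (hits S' xs))
      = (real (hits (S \<union> S') xs))\<^sup>2 - (real (hits S xs))\<^sup>2 - (real (hits S' xs))\<^sup>2" for xs
    by (simp add: hits_Un_disjoint[OF assms] power2_eq_square algebra_simps)
  then have "2 * ?E (\<lambda>xs. real (hits S xs) * real (hits S' xs))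
      = ?E (\<lambda>xs. (real (hits (S \<union> S') xs))\<^sup>2 - (real (hits S xs))\<^sup>2 - (real (hits S' xs))\<^sup>2)"
    by (simp flip: Bochner_Integration.integral_mult_right_zero)
  also have "\<dots> = ?E (\<lambda>xs. (real (hits (S \<union> S') xs))\<^sup>2)
      - ?E (\<lambda>xs. (real (hits S xs))\<^sup>2) - ?E (\<lambda>xs. (real (hits S' xs))\<^sup>2)"
    by (simp add: integrable_hits[where f = "\<lambda>k. (real k)\<^sup>2"])
  also have "\<dots> = 2 * (real n * (real n - 1) * (measure_pmf.prob p S * measure_pmf.prob p S'))"
    unfolding expectation_hits_power2 measure_pmf.finite_measure_Union[OF _ _ assms, simplified]
    by (simp add: power2_eq_square algebra_simps)
  finally show ?thesis by simp
qed

lemma prob_hits_deviation_le: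
  assumes "0 < d"
  shows "measure_pmf.prob (replicate_pmf n p) {xs. d \<le> \<bar>hits S xs - n * measure_pmf.prob p S\<bar>}
    \<le> n * measure_pmf.prob p S / d\<^sup>2"
proof -
  let ?h = "measure_pmf.prob p S"
  have "measure_pmf.prob (replicate_pmf n p) {xs. d \<le> \<bar>hits S xs - n * ?h\<bar>}
      \<le> measure_pmf.variance (replicate_pmf n p) (\<lambda>xs. real (hits S xs)) / d\<^sup>2"
    using measure_pmf.Chebyshev_inequality[OF _ integrable_hits[where f = "\<lambda>k. (real k)\<^sup>2"] assms]
    by (simp add: expectation_hits)
  also have "measure_pmf.variance (replicate_pmf n p) (\<lambda>xs. real (hits S xs))
      = measure_pmf.variance (binomial_pmf n ?h) real"
    by (simp add: expectation_hits expectation_binomial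
        expectation_hits_eq_binomial[where f = "\<lambda>k. (real k - n * ?h)\<^sup>2"])
  also have "\<dots> / d\<^sup>2 \<le> n * ?h / d\<^sup>2"
    by (intro divide_right_mono variance_binomial_le) auto
  finally show ?thesis .
qed

lemma prob_hits_greater:
  "measure_pmf.prob (replicate_pmf n p) {xs. t < hits S xs}
    = binomial_tail n t (measure_pmf.prob p S)"
proof -
  have "measure_pmf.prob (replicate_pmf n p) {xs. t < hits S xs}
      = measure_pmf.prob (map_pmf (hits S) (replicate_pmf n p)) {t<..}"
    by (simp add: vimage_def)
  also have "\<dots> = binomial_tail n t (measure_pmf.prob p S)"
    unfolding map_pmf_hits_eq_binomial by (rule prob_binomial_greaterThan) simp
  finally show ?thesis .
qed

lemma prob_hits_le:
  "measure_pmf.prob (replicate_pmf n p) {xs. hits S xs \<le> t}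
    = 1 - binomial_tail n t (measure_pmf.prob p S)"
proof -
  have "{xs. hits S xs \<le> t} = UNIV - {xs. t < hits S xs}" by auto
  then show ?thesis
    using measure_pmf.prob_compl[of "{xs. t < hits S xs}" "replicate_pmf n p"]
    by (simp add: prob_hits_greater)
qed

lemma prob_hits_between:
  assumes "S \<subseteq> S'"
  shows "measure_pmf.prob (replicate_pmf n p) {xs. hits S xs \<le> t \<and> t < hits S' xs}
    = binomial_tail n t (measure_pmf.prob p S') - binomial_tail n t (measure_pmf.prob p S)"
proof -
  have "{xs. hits S xs \<le> t \<and> t < hits S' xs} = {xs. t < hits S' xs} - {xs. t < hits S xs}"
    by auto
  moreover have "{xs. t < hits S xs} \<subseteq> {xs. t < hits S' xs}"
    using hits_mono[OF assms] by (auto intro: less_le_trans)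
  ultimately show ?thesis by (simp add: measure_pmf.finite_measure_Diff prob_hits_greater)
qed

subsection \<open>Selecting far points\<close>

lemma expectation_hits_of_bool_ge:
  assumes disj: "G \<inter> B = {}" and t: "0 < t" "3 * (k * measure_pmf.prob p B) \<le> 2 * real t"
  shows "k * measure_pmf.prob p G / 3
    \<le> measure_pmf.expectation (replicate_pmf k p) (\<lambda>xs. hits G xs * of_bool (hits B xs < t))"
proof -
  let ?E = "measure_pmf.expectation (replicate_pmf k p)"
  define X where "X = k * measure_pmf.prob p G"
  have "X / 3 \<le> X - real k * (real k - 1) * (measure_pmf.prob p G * measure_pmf.prob p B) / t"
  proof -
    have "real k * (real k - 1) * (measure_pmf.prob p G * measure_pmf.prob p B)
        \<le> real k * real k * (measure_pmf.prob p G * measure_pmf.prob p B)"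
      by (intro mult_right_mono mult_left_mono) auto
    also have "\<dots> = X * (k * measure_pmf.prob p B)" unfolding X_def by simp
    also have "\<dots> \<le> X * (2 / 3 * t)" using t by (intro mult_left_mono) (auto simp: X_def)
    finally show ?thesis using t(1) by (simp add: field_simps)
  qed
  also have "\<dots> = ?E (\<lambda>xs. real (hits G xs) - real (hits G xs) * real (hits B xs) / t)"
    by (simp add: X_def expectation_hits expectation_hits_mult_disjoint[OF disj]
        integrable_hits integrable_hits2[where f = "\<lambda>i j. real i * real j"])
  also have "\<dots> \<le> ?E (\<lambda>xs. hits G xs * of_bool (hits B xs < t))"
  proof (rule integral_mono)
    fix xs
    show "real (hits G xs) - real (hits G xs) * real (hits B xs) / t
        \<le> hits G xs * of_bool (hits B xs < t)"
    proof (cases "hits B xs < t")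
      case False
      then have "real (hits G xs) * 1 \<le> real (hits G xs) * (hits B xs / t)"
        using t(1) by (intro mult_left_mono) auto
      then show ?thesis using False by simp
    qed simp
  qed (use integrable_hits2[where f = "\<lambda>i j. real i - real i * real j / t"]
      integrable_hits2[where f = "\<lambda>i j. real i * of_bool (j < t)"] in auto)
  finally show ?thesis unfolding X_def .
qed

lemma prob_hits_pos_less_ge:
  assumes disj: "G \<inter> B = {}" and t: "0 < t" "3 * (k * measure_pmf.prob p B) \<le> 2 * real t"
    and X: "X = k * measure_pmf.prob p G"
  shows "X / (9 * (1 + X))
    \<le> measure_pmf.prob (replicate_pmf k p) {xs. 0 < hits G xs \<and> hits B xs < t}"
proof (cases "X = 0")
  case False
  let ?E = "measure_pmf.expectation (replicate_pmf k p)"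
    and ?pr = "measure_pmf.prob (replicate_pmf k p)"
  define Z where "Z xs = hits G xs * of_bool (hits B xs < t)" for xs
  have X0: "0 < X" using False unfolding X by (simp add: zero_less_mult_iff zero_less_measure_iff)
  have int_Z2: "integrable (replicate_pmf k p) (\<lambda>xs. (real (Z xs))\<^sup>2)"
    unfolding Z_def by (rule integrable_hits2[where f = "\<lambda>i j. (real (i * of_bool (j < t)))\<^sup>2"])
  have "X / 3 \<le> ?E Z"
    unfolding X Z_def using expectation_hits_of_bool_ge[OF disj t] by simp
  then have "(X / 3)\<^sup>2 \<le> (?E Z)\<^sup>2" using X0 by (intro power_mono) auto
  also have "\<dots> \<le> ?E (\<lambda>xs. (Z xs)\<^sup>2) * ?pr {xs. Z xs \<noteq> 0}"
    using measure_pmf.power2_expectation_le[OF _ int_Z2] by simp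
  also have "\<dots> \<le> X * (1 + X) * ?pr {xs. Z xs \<noteq> 0}"
  proof (rule mult_right_mono)
    have "?E (\<lambda>xs. (Z xs)\<^sup>2) \<le> ?E (\<lambda>xs. (real (hits G xs))\<^sup>2)"
      using int_Z2 by (intro integral_mono integrable_hits) (auto simp: Z_def)
    also have "\<dots> \<le> X * (1 + X)" unfolding X by (rule expectation_hits_power2_le)
    finally show "?E (\<lambda>xs. (Z xs)\<^sup>2) \<le> X * (1 + X)" .
  qed simp
  finally have "X * (X / 9) \<le> X * ((1 + X) * ?pr {xs. Z xs \<noteq> 0})"
    by (simp add: power2_eq_square mult.assoc)
  then have "X / 9 \<le> (1 + X) * ?pr {xs. Z xs \<noteq> 0}"
    using X0 by (simp only: mult_le_cancel_left_pos)
  then have "X / (9 * (1 + X)) \<le> ?pr {xs. Z xs \<noteq> 0}"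
    using X0 by (simp add: field_simps)
  also have "{xs. Z xs \<noteq> 0} = {xs. 0 < hits G xs \<and> hits B xs < t}"
    by (auto simp: Z_def)
  finally show ?thesis .
qed simp

lemma expectation_ge_prob_mult:
  fixes f :: "'a \<Rightarrow> real"
  assumes "integrable (measure_pmf p) f" "\<And>x. 0 \<le> f x" "0 < c"
  shows "c * measure_pmf.prob p {x. c \<le> f x} \<le> measure_pmf.expectation p f"
  using integral_Markov_inequality_measure[of p f UNIV c] assms by (simp add: field_simps)

text \<open>If only points of \<open>B\<close> can be farther than points of \<open>G\<close>, then the \<open>t\<close> farthest points of \<open>xs\<close>
  include this many points of \<open>G\<close>. The subtraction is the truncated one.\<close>

definition forced_hits :: "nat \<Rightarrow> 'a set \<Rightarrow> 'a set \<Rightarrow> 'a list \<Rightarrow> nat" where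
  "forced_hits t G B xs = min (hits G xs) (t - hits B xs)"

lemma integrable_forced_hits:
  fixes f :: "nat \<Rightarrow> real"
  shows "integrable (replicate_pmf k p) (\<lambda>xs. f (forced_hits t G B xs))"
  unfolding forced_hits_def by (rule integrable_hits2[where f = "\<lambda>i j. f (min i (t - j))"])

context
  fixes p :: "'a pmf" and k t :: nat and G B :: "'a set" and x w :: real
  assumes disj: "G \<inter> B = {}" and x: "0 < x" "x \<le> k * measure_pmf.prob p G"
    and w: "w = k * measure_pmf.prob p B" "15 * x \<le> w" and t: "real t = 3 / 2 * (w + x)"
begin

lemma expectation_forced_hits_ge_large:
  assumes large: "1000 \<le> x"
  shows "18 / 25 * x \<le> measure_pmf.expectation (replicate_pmf k p) (forced_hits t G B)"
proof -
  let ?pr = "measure_pmf.prob (replicate_pmf k p)" and ?m = "forced_hits t G B"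
  define X where "X = k * measure_pmf.prob p G"
  have X: "x \<le> X" using x unfolding X_def by simp
  define few_G where "few_G = {xs. X / 10 \<le> \<bar>hits G xs - X\<bar>}"
  define many_B where "many_B = {xs. w / 2 \<le> \<bar>hits B xs - w\<bar>}"
  have "?pr few_G \<le> X / (X / 10)\<^sup>2"
    unfolding few_G_def X_def using X x(1) by (intro prob_hits_deviation_le) (simp add: X_def)
  moreover have "?pr many_B \<le> w / (w / 2)\<^sup>2"
    using prob_hits_deviation_le[of "w / 2" k p B] w x(1) unfolding many_B_def by simp
  moreover have "X / (X / 10)\<^sup>2 \<le> 1 / 10" "w / (w / 2)\<^sup>2 \<le> 1 / 10"
    using X large w by (simp_all add: power2_eq_square field_simps)
  moreover have "?pr (few_G \<union> many_B) \<le> ?pr few_G + ?pr many_B"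
    by (rule measure_Un_le) auto
  moreover have "?pr (- (few_G \<union> many_B)) = 1 - ?pr (few_G \<union> many_B)"
    using measure_pmf.prob_compl[of "few_G \<union> many_B" "replicate_pmf k p"]
    by (simp add: Compl_eq_Diff_UNIV)
  ultimately have "8 / 10 \<le> ?pr (- (few_G \<union> many_B))" by linarith
  also have "\<dots> \<le> ?pr {xs. 9 / 10 * x \<le> ?m xs}"
  proof (intro measure_pmf.finite_measure_mono subsetI CollectI)
    fix xs assume "xs \<in> - (few_G \<union> many_B)"
    then have "9 / 10 * X < hits G xs" "hits B xs < 3 / 2 * w"
      unfolding few_G_def many_B_def by (auto simp: abs_if split: if_splits)
    moreover from this have "9 / 10 * x \<le> real t - hits B xs"
      using x(1) by (simp add: t algebra_simps)
    ultimately have "9 / 10 * x \<le> hits G xs" "9 / 10 * x \<le> real (t - hits B xs)"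
      using X x(1) by auto
    then show "9 / 10 * x \<le> ?m xs" by (simp add: forced_hits_def min_def)
  qed simp
  finally have "9 / 10 * x * (8 / 10) \<le> 9 / 10 * x * ?pr {xs. 9 / 10 * x \<le> ?m xs}"
    using x(1) by (intro mult_left_mono) auto
  also have "\<dots> \<le> measure_pmf.expectation (replicate_pmf k p) ?m"
    using x(1) by (intro expectation_ge_prob_mult integrable_forced_hits) auto
  finally show ?thesis by simp
qed

lemma expectation_forced_hits_ge_small:
  assumes small: "x \<le> 1000"
  shows "x / 9009 \<le> measure_pmf.expectation (replicate_pmf k p) (forced_hits t G B)"
proof -
  let ?m = "forced_hits t G B"
  define X where "X = k * measure_pmf.prob p G"
  have X: "x \<le> X" using x unfolding X_def by simp
  have pos: "0 < t" using t x(1) w(2) by (cases t) auto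
  have "x / 9009 \<le> x / (9 * (1 + x))" using small x by (intro divide_left_mono) auto
  also have "\<dots> \<le> X / (9 * (1 + X))" using X x by (simp add: field_simps)
  also have "\<dots> \<le> measure_pmf.prob (replicate_pmf k p) {xs. 0 < hits G xs \<and> hits B xs < t}"
    unfolding X_def using t x(1) w(1) by (intro prob_hits_pos_less_ge[OF disj pos]) auto
  also have "\<dots> = 1 * measure_pmf.prob (replicate_pmf k p) {xs. 1 \<le> real (?m xs)}"
    by (auto intro!: arg_cong[of _ _ "measure_pmf.prob _"] simp: forced_hits_def)
  also have "\<dots> \<le> measure_pmf.expectation (replicate_pmf k p) ?m"
    by (intro expectation_ge_prob_mult integrable_forced_hits) auto
  finally show ?thesis .
qed

lemma expectation_forced_hits_ge_confidence:
  assumes e: "0 \<le> e" "e \<le> 1" "e \<le> x / 10 ^ 7"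
  shows "13 / 24 * e * x \<le> measure_pmf.expectation (replicate_pmf k p) (forced_hits t G B)"
proof (cases "1000 \<le> x")
  case True
  have "13 / 24 * e * x \<le> 18 / 25 * x" using e x by (intro mult_right_mono) auto
  then show ?thesis using expectation_forced_hits_ge_large[OF True] by linarith
next
  case False
  have "13 / 24 * e * x \<le> 1 / 9009 * x"
    using e x False by (intro mult_right_mono) auto
  then show ?thesis using expectation_forced_hits_ge_small False by auto
qed

end

lemma farthest_points_size_ge:
  assumes far: "farthest_points t c xs Q" and xs: "set xs \<subseteq> P"
    and G: "G = {x \<in> U. r < dist x c}"
  shows "forced_hits t G (P - U) xs \<le> size (filter_mset (\<lambda>x. x \<in> G) Q)"
proof (cases "\<exists>y. y \<in># mset xs - Q \<and> y \<in> G")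
  case True
  have sub: "Q \<subseteq># mset xs" and size_Q: "size Q = min t (length xs)"
    and farther: "\<And>x y. x \<in># Q \<Longrightarrow> y \<in># mset xs - Q \<Longrightarrow> dist y c \<le> dist x c"
    using far unfolding farthest_points_def by auto
  obtain y where y: "y \<in># mset xs - Q" "y \<in> G" using True by blast
  then have "Q \<noteq> mset xs" by auto
  then have "size Q \<noteq> length xs"
    using sub by (metis mset_subset_size nless_le size_mset subset_mset.le_imp_less_or_eq)
  then have "size Q = t" using size_Q by auto
  moreover have "x \<in> G \<longleftrightarrow> \<not> x \<in> P - U" if "x \<in># Q" for x
  proof -
    have "r < dist x c" using farther[OF that y(1)] y(2) unfolding G by auto
    moreover have "x \<in> P" using mset_subset_eqD[OF sub that] xs by auto
    ultimately show ?thesis unfolding G by auto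
  qed
  then have "filter_mset (\<lambda>x. x \<in> G) Q = filter_mset (\<lambda>x. \<not> x \<in> P - U) Q"
    by (intro filter_mset_cong) auto
  then have "size Q = size (filter_mset (\<lambda>x. x \<in> G) Q) + size (filter_mset (\<lambda>x. x \<in> P - U) Q)"
    by (metis add.commute multiset_partition size_union)
  moreover have "size (filter_mset (\<lambda>x. x \<in> P - U) Q) \<le> hits (P - U) xs"
    unfolding hits_eq_size_filter_mset by (intro size_mset_mono multiset_filter_mono sub)
  ultimately show ?thesis unfolding forced_hits_def by linarith
next
  case False
  then have "filter_mset (\<lambda>x. x \<in> G) (mset xs - Q) = {#}"
    unfolding filter_mset_eq_mempty_iff by blast
  moreover have "Q \<subseteq># mset xs" using far unfolding farthest_points_def by simp
  ultimately have "filter_mset (\<lambda>x. x \<in> G) (mset xs) = filter_mset (\<lambda>x. x \<in> G) Q"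
    by (metis add.right_neutral filter_union_mset subset_mset.add_diff_inverse)
  then show ?thesis unfolding forced_hits_def hits_eq_size_filter_mset by simp
qed

lemma prob_pmf_of_multiset:
  assumes "M \<noteq> {#}"
  shows "measure_pmf.prob (pmf_of_multiset M) S = size (filter_mset (\<lambda>x. x \<in> S) M) / size M"
proof -
  have "measure_pmf.prob (pmf_of_multiset M) S
      = measure_pmf.prob (pmf_of_multiset M) (S \<inter> set_mset M)"
    using measure_Int_set_pmf[of "pmf_of_multiset M" S] assms by simp
  also have "\<dots> = (\<Sum>x\<in>S \<inter> set_mset M. count M x / size M)"
    using assms by (simp add: measure_measure_pmf_finite)
  also have "\<dots> = real (\<Sum>x\<in>S \<inter> set_mset M. count M x) / size M"
    by (simp add: sum_divide_distrib)
  also have "(\<Sum>x\<in>S \<inter> set_mset M. count M x) = size (filter_mset (\<lambda>x. x \<in> S) M)"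
    by (auto simp: size_multiset_overloaded_eq intro!: sum.cong)
  finally show ?thesis .
qed

text \<open>Ranks are counted by strictly farther points, so that ties enlarge the set.\<close>

definition farthest_ranked :: "'a::metric_space set \<Rightarrow> real \<Rightarrow> 'a \<Rightarrow> 'a set" where
  "farthest_ranked P \<kappa> c = {x \<in> P. real (card {y \<in> P. dist x c < dist y c}) \<le> \<kappa>}"

lemma card_farthest_ranked_ge:
  fixes \<kappa> :: real
  assumes "finite P" "\<kappa> \<le> card P"
  shows "\<kappa> \<le> card (farthest_ranked P \<kappa> c)"
proof (cases "P \<subseteq> farthest_ranked P \<kappa> c")
  case True
  then have "farthest_ranked P \<kappa> c = P" unfolding farthest_ranked_def by auto
  then show ?thesis using assms by simp
next
  case False
  let ?N = "P - farthest_ranked P \<kappa> c"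
  have "finite ?N" "?N \<noteq> {}" using assms False by auto
  then obtain y where y: "y \<in> ?N" "\<And>x. x \<in> ?N \<Longrightarrow> dist x c \<le> dist y c"
    using arg_min_if_finite[of ?N "\<lambda>x. - dist x c"] by (metis neg_less_iff_less not_le)
  have "{x \<in> P. dist y c < dist x c} \<subseteq> farthest_ranked P \<kappa> c"
    using y(2) by force
  then have "card {x \<in> P. dist y c < dist x c} \<le> card (farthest_ranked P \<kappa> c)"
    using assms by (intro card_mono) (auto simp: farthest_ranked_def)
  moreover have "\<kappa> < card {x \<in> P. dist y c < dist x c}"
    using y(1) unfolding farthest_ranked_def by auto
  ultimately show ?thesis by linarith
qed

lemma subset_farthest_ranked:
  fixes \<kappa> :: real
  assumes "finite P" "card {x \<in> P. r < dist x c} \<le> \<kappa>"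
  shows "{x \<in> P. r < dist x c} \<subseteq> farthest_ranked P \<kappa> c"
proof
  fix x assume x: "x \<in> {x \<in> P. r < dist x c}"
  then have "card {y \<in> P. dist x c < dist y c} \<le> card {y \<in> P. r < dist y c}"
    using assms(1) by (intro card_mono) auto
  then show "x \<in> farthest_ranked P \<kappa> c"
    using x assms(2) unfolding farthest_ranked_def by simp
qed

lemma card_cball_kth_largest_ge:
  fixes \<kappa> :: real
  assumes fin: "finite P" and hits: "t < hits (farthest_ranked P \<kappa> c) ys"
  shows "card P - \<kappa> \<le> card (P \<inter> cball c (kth_largest (t + 1) (map (\<lambda>y. dist y c) ys)))"
proof -
  let ?H = "farthest_ranked P \<kappa> c" and ?l = "kth_largest (t + 1) (map (\<lambda>y. dist y c) ys)"
  have "?H \<noteq> {}" using hits unfolding hits_def by auto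
  moreover have "finite ?H" using fin unfolding farthest_ranked_def by auto
  ultimately obtain x where x: "x \<in> ?H" "\<And>y. y \<in> ?H \<Longrightarrow> dist x c \<le> dist y c"
    using arg_min_if_finite[of ?H "\<lambda>x. dist x c"] by (metis not_le)
  define far_x where "far_x = {y \<in> P. dist x c < dist y c}"
  have far_x: "far_x \<subseteq> P" "finite far_x" "card far_x \<le> \<kappa>"
    using x(1) fin unfolding far_x_def farthest_ranked_def by auto
  have "hits ?H ys \<le> length (filter (\<lambda>r. dist x c \<le> r) (map (\<lambda>y. dist y c) ys))"
    by (induction ys) (auto dest: x(2))
  then have "dist x c \<le> ?l"
    using hits by (intro kth_largest_ge) auto
  then have "P - far_x \<subseteq> P \<inter> cball c ?l"
    unfolding far_x_def by (auto simp: dist_commute)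
  then have "card (P - far_x) \<le> card (P \<inter> cball c ?l)"
    using fin by (intro card_mono) auto
  then show ?thesis
    using far_x card_mono[OF fin far_x(1)] by (simp add: card_Diff_subset)
qed

subsection \<open>The algorithm\<close>

locale outlier_sampling =
  fixes P Popt :: "'a::euclidean_space set"
    and \<gamma> \<epsilon> \<eta>\<^sub>1 \<eta>\<^sub>2 \<delta> :: real
    and z n' n'' t' t'' :: nat
    and ctr :: "'a set \<Rightarrow> 'a"
    and far :: "'a \<Rightarrow> 'a list \<Rightarrow> 'a multiset"
  assumes fin: "finite P" and nonempty: "P \<noteq> {}"
    and gamma: "0 < \<gamma>" "\<gamma> < 1" and eps: "0 < \<epsilon>"
    and eta1: "0 < \<eta>\<^sub>1" "\<eta>\<^sub>1 < 1" and eta2: "0 < \<eta>\<^sub>2" "\<eta>\<^sub>2 < 1"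
    and delta: "0 < \<delta>" "\<delta> < \<gamma> / 3"
    and opt: "outlier_opt P \<gamma> Popt"
    and z: "real z = 2 / \<epsilon> + 1"
    and n': "5 * 10 ^ 7 * (1 - \<eta>\<^sub>1) \<le> n' * \<delta>"
    and n'': "1000 * (1 - \<eta>\<^sub>2) * \<gamma> \<le> n'' * \<delta>\<^sup>2"
    and t': "real t' = 3 / 2 * (\<delta> / 5 + \<gamma>) * real n'"
    and t'': "real t'' = (1 + \<delta> / (5 * \<gamma>))\<^sup>2 * \<gamma> * real n''"
    and ctr: "\<And>T. T \<subseteq> P \<Longrightarrow> T \<noteq> {} \<Longrightarrow>
      approx_MEB_center (\<epsilon> / (2 + \<epsilon>) * (\<epsilon> / (1 + \<epsilon>))) T (ctr T)"
    and far: "\<And>c xs. farthest_points t' c xs (far c xs)"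
begin

abbreviation "R \<equiv> Rad Popt"
abbreviation "unif \<equiv> pmf_of_set P"
abbreviation "sample_prob k \<equiv> measure_pmf.prob (replicate_pmf k unif)"
abbreviation "approx \<equiv> outlier_approx P \<gamma> Popt \<epsilon> \<delta>"

definition selection_rate :: real where
  "selection_rate = (\<delta> / 5) / (3 * (\<gamma> + \<delta> / 5))"

definition outside :: "'a \<Rightarrow> 'a set" where
  "outside c = {x \<in> P. (1 + \<epsilon>) * R < dist x c}"

abbreviation "far_inliers c \<equiv> Popt \<inter> outside c"

definition radius_est :: "'a \<Rightarrow> 'a list \<Rightarrow> real" where
  "radius_est c ys = kth_largest (t'' + 1) (map (\<lambda>y. dist y c) ys)"

definition covers :: "'a \<times> real \<Rightarrow> bool" where
  "covers b \<longleftrightarrow> (1 - \<delta> - \<gamma>) * real (card P) \<le> real (card (P \<inter> cball (fst b) (snd b)))"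

lemma approx_iff: "approx b \<longleftrightarrow> covers b \<and> snd b \<le> (1 + \<epsilon>) * R"
  unfolding outlier_approx_def covers_def by simp

lemma Popt: "Popt \<subseteq> P" "Popt \<noteq> {}" "finite Popt" "real (card Popt) = (1 - \<gamma>) * real (card P)"
proof -
  show Popt_opt: "Popt \<subseteq> P" "real (card Popt) = (1 - \<gamma>) * real (card P)"
    using opt unfolding outlier_opt_def by auto
  then show "finite Popt" using fin finite_subset by blast
  have "0 < real (card Popt)" using Popt_opt gamma fin nonempty by (simp add: card_gt_0_iff)
  then show "Popt \<noteq> {}" by auto
qed

lemma R_nonneg: "0 \<le> R"
  using Popt by (intro Rad_nonneg finite_imp_bounded)

lemma Rad_le_R: "T \<subseteq> Popt \<Longrightarrow> T \<noteq> {} \<Longrightarrow> Rad T \<le> R"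
  using Popt by (intro Rad_mono finite_imp_bounded)

lemma card_P_pos: "0 < real (card P)"
  using fin nonempty by (simp add: card_gt_0_iff)

lemma prob_unif: "measure_pmf.prob unif S = card (P \<inter> S) / card P"
  using fin nonempty by (simp add: measure_pmf_of_set)

lemma set_sample: "xs \<in> set_pmf (replicate_pmf k unif) \<longleftrightarrow> set xs \<subseteq> P \<and> length xs = k"
  using fin nonempty by (auto simp: set_replicate_pmf)

lemma n'_pos: "0 < n'"
  using n' eta1 delta by (cases "n' = 0") auto

lemma n''_pos: "0 < n''"
proof -
  have "0 < 1000 * (1 - \<eta>\<^sub>2) * \<gamma>" using eta2 gamma by simp
  then show ?thesis using n'' by (cases "n'' = 0") auto
qed

lemma z_pos: "0 < z"
  using z eps by (cases "z = 0") (auto simp: add_pos_pos less_imp_neq)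

lemma selection_rate_pos: "0 < selection_rate"
  unfolding selection_rate_def using delta gamma by simp

subsection \<open>Radius estimates\<close>

definition slack :: real where "slack = \<delta> / (5 * \<gamma>)"
definition mean_outliers :: real where "mean_outliers = \<gamma> * n''"

lemma slack: "0 < slack" "slack < 1 / 15"
  unfolding slack_def using delta gamma by (auto simp: field_simps)

lemma mean_outliers_pos: "0 < mean_outliers"
  unfolding mean_outliers_def using gamma n''_pos by simp

lemma t''_eq: "real t'' = (1 + slack)\<^sup>2 * mean_outliers"
  unfolding t'' slack_def mean_outliers_def by simp

lemma slack_mean_outliers:
  "(1 + slack) * mean_outliers = n'' * (\<gamma> + \<delta> / 5)"
  "(1 + 5 * slack) * mean_outliers = n'' * (\<gamma> + \<delta>)"
  unfolding slack_def mean_outliers_def using gamma by (auto simp: field_simps)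

lemma selection_rate_eq_slack: "selection_rate = slack / (3 * (1 + slack))"
  unfolding slack_def selection_rate_def using delta gamma by (simp add: field_simps)

lemma one_minus_eta2: "1 - \<eta>\<^sub>2 \<le> slack\<^sup>2 * mean_outliers / 40"
  unfolding slack_def mean_outliers_def using n'' gamma by (simp add: power2_eq_square field_simps)

abbreviation "top_ranked c \<equiv> farthest_ranked P ((\<gamma> + \<delta>) * card P) c"

lemma covers_if_hits:
  assumes "t'' < hits (top_ranked c) ys"
  shows "covers (c, radius_est c ys)"
  using card_cball_kth_largest_ge[OF fin assms] unfolding covers_def radius_est_def
  by (simp add: algebra_simps)

lemma covers_if_large: "1 \<le> \<gamma> + \<delta> \<Longrightarrow> covers b"
  unfolding covers_def by (rule order_trans[of _ 0]) (auto intro: mult_nonpos_nonneg)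

lemma radius_est_le_if_hits:
  assumes "set ys \<subseteq> P" "hits (outside c) ys \<le> t''"
  shows "radius_est c ys \<le> (1 + \<epsilon>) * R"
  unfolding radius_est_def
proof (rule kth_largest_le)
  have "length (filter (\<lambda>x. (1 + \<epsilon>) * R < x) (map (\<lambda>y. dist y c) ys)) = hits (outside c) ys"
    using assms(1) unfolding outside_def by (induction ys) auto
  then show "length (filter (\<lambda>x. (1 + \<epsilon>) * R < x) (map (\<lambda>y. dist y c) ys)) \<le> t''"
    using assms(2) by simp
  show "0 \<le> (1 + \<epsilon>) * R" using R_nonneg eps by simp
qed

lemma top_ranked_mean_ge:
  assumes "\<gamma> + \<delta> < 1"
  shows "(1 + 5 * slack) * mean_outliers \<le> n'' * measure_pmf.prob unif (top_ranked c)"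
proof -
  have "(\<gamma> + \<delta>) * card P \<le> card (top_ranked c)"
    using assms mult_right_mono[of "\<gamma> + \<delta>" 1 "real (card P)"]
    by (intro card_farthest_ranked_ge fin) auto
  moreover have "P \<inter> top_ranked c = top_ranked c" unfolding farthest_ranked_def by auto
  ultimately have "\<gamma> + \<delta> \<le> measure_pmf.prob unif (top_ranked c)"
    unfolding prob_unif using card_P_pos by (simp add: pos_le_divide_eq)
  then show ?thesis unfolding slack_mean_outliers by (intro mult_left_mono) auto
qed

lemma outside_mean_le:
  assumes few: "card (outside c) \<le> (\<gamma> + \<delta> / 5) * card P"
  shows "n'' * measure_pmf.prob unif (outside c) \<le> (1 + slack) * mean_outliers"
proof -
  have "P \<inter> outside c = outside c" unfolding outside_def by auto
  then have "measure_pmf.prob unif (outside c) \<le> \<gamma> + \<delta> / 5"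
    unfolding prob_unif using few card_P_pos by (simp add: pos_divide_le_eq)
  then show ?thesis unfolding slack_mean_outliers by (intro mult_left_mono) auto
qed

text \<open>The factor 12/13 lost here is regained by the factor 13/12 in \<open>prob_next_point_ge\<close>.\<close>

lemma prob_covers_ge:
  "12 / 13 * (1 - \<eta>\<^sub>2) \<le> sample_prob n'' {ys. covers (c, radius_est c ys)}"
proof (cases "\<gamma> + \<delta> < 1")
  case True
  have "12 / 13 * (1 - \<eta>\<^sub>2) \<le> sample_prob n'' {ys. t'' < hits (top_ranked c) ys}"
    unfolding prob_hits_greater
  proof (rule binomial_tail_ge_confidence[OF slack mean_outliers_pos t''_eq])
    show "(1 + 5 * slack) * mean_outliers \<le> n'' * measure_pmf.prob unif (top_ranked c)"
      by (rule top_ranked_mean_ge[OF True])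
  qed (use eta2 one_minus_eta2 in auto)
  also have "\<dots> \<le> sample_prob n'' {ys. covers (c, radius_est c ys)}"
    by (intro measure_pmf.finite_measure_mono) (auto simp: covers_if_hits)
  finally show ?thesis .
next
  case False
  then show ?thesis using covers_if_large eta2 by simp
qed

lemma sample_prob_le_approx:
  assumes "\<And>ys. ys \<in> S \<Longrightarrow> hits (outside c) ys \<le> t''"
    and "\<And>ys. ys \<in> S \<Longrightarrow> covers (c, radius_est c ys)"
  shows "sample_prob n'' S \<le> sample_prob n'' {ys. approx (c, radius_est c ys)}"
  using assms radius_est_le_if_hits
  by (intro measure_pmf.finite_measure_mono_AE)
     (auto simp: AE_measure_pmf_iff set_sample approx_iff)

lemma prob_approx_ge:
  assumes few: "card (outside c) \<le> (\<gamma> + \<delta> / 5) * card P"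
  shows "(1 - \<eta>\<^sub>2) * selection_rate \<le> sample_prob n'' {ys. approx (c, radius_est c ys)}"
proof (cases "\<gamma> + \<delta> < 1")
  case True
  have "(\<gamma> + \<delta> / 5) * card P \<le> (\<gamma> + \<delta>) * card P" using delta by (intro mult_right_mono) auto
  then have "card (outside c) \<le> (\<gamma> + \<delta>) * card P" using few by linarith
  then have sub: "outside c \<subseteq> top_ranked c"
    unfolding outside_def by (rule subset_farthest_ranked[OF fin])
  have "(1 - \<eta>\<^sub>2) * selection_rate
      \<le> sample_prob n'' {ys. hits (outside c) ys \<le> t'' \<and> t'' < hits (top_ranked c) ys}"
    unfolding selection_rate_eq_slack prob_hits_between[OF sub]
  proof (rule binomial_tail_diff_ge_confidence[OF slack mean_outliers_pos t''_eq])
    show "n'' * measure_pmf.prob unif (outside c) \<le> (1 + slack) * mean_outliers"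
      by (rule outside_mean_le[OF few])
    show "(1 + 5 * slack) * mean_outliers \<le> n'' * measure_pmf.prob unif (top_ranked c)"
      by (rule top_ranked_mean_ge[OF True])
  qed (use eta2 one_minus_eta2 in auto)
  also have "\<dots> \<le> sample_prob n'' {ys. approx (c, radius_est c ys)}"
    by (rule sample_prob_le_approx) (auto intro: covers_if_hits)
  finally show ?thesis .
next
  case False
  have "(1 - \<eta>\<^sub>2) * selection_rate \<le> sample_prob n'' {ys. hits (outside c) ys \<le> t''}"
    unfolding selection_rate_eq_slack prob_hits_le
  proof (rule one_minus_binomial_tail_ge_confidence[OF slack mean_outliers_pos t''_eq])
    show "n'' * measure_pmf.prob unif (outside c) \<le> (1 + slack) * mean_outliers"
      by (rule outside_mean_le[OF few])
  qed (use eta2 one_minus_eta2 in auto)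
  also have "\<dots> \<le> sample_prob n'' {ys. approx (c, radius_est c ys)}"
    using False by (intro sample_prob_le_approx covers_if_large) auto
  finally show ?thesis .
qed

subsection \<open>Selection of the next point\<close>

definition next_point :: "'a \<Rightarrow> 'a pmf" where
  "next_point c = bind_pmf (replicate_pmf n' unif) (\<lambda>xs. pmf_of_multiset (far c xs))"

lemma t'_pos: "0 < t'"
proof -
  have "0 < real t'" unfolding t' using delta gamma n'_pos by simp
  then show ?thesis by simp
qed

lemma
  assumes "xs \<in> set_pmf (replicate_pmf n' unif)"
  shows far_nonempty: "far c xs \<noteq> {#}"
    and size_far_le: "size (far c xs) \<le> t'"
    and set_far_subset: "set_mset (far c xs) \<subseteq> P"
proof -
  have "size (far c xs) = min t' n'" and sub: "far c xs \<subseteq># mset xs"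
    using far[of c xs] assms unfolding farthest_points_def by (simp_all add: set_sample)
  then show "far c xs \<noteq> {#}" "size (far c xs) \<le> t'" using t'_pos n'_pos by auto
  show "set_mset (far c xs) \<subseteq> P"
    using sub assms by (auto simp: set_sample dest!: set_mset_mono subsetD)
qed

lemma set_next_point: "set_pmf (next_point c) \<subseteq> P"
  unfolding next_point_def using far_nonempty set_far_subset by fastforce

lemma prob_unif_outliers: "measure_pmf.prob unif (P - Popt) = \<gamma>"
proof -
  have "card (P - Popt) = \<gamma> * card P"
    using Popt fin card_mono[OF fin Popt(1)] by (simp add: card_Diff_subset algebra_simps)
  then show ?thesis
    unfolding prob_unif using card_P_pos by (simp add: Int_absorb1)
qed

lemma prob_unif_far_inliers_ge:
  assumes many: "(\<gamma> + \<delta> / 5) * card P < card (outside c)"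
  shows "\<delta> / 5 \<le> measure_pmf.prob unif (far_inliers c)"
proof -
  have "\<gamma> + \<delta> / 5 < measure_pmf.prob unif (outside c)"
  proof -
    have "P \<inter> outside c = outside c" unfolding outside_def by auto
    then show ?thesis unfolding prob_unif using many card_P_pos by (simp add: pos_less_divide_eq)
  qed
  also have "\<dots> \<le> measure_pmf.prob unif ((far_inliers c) \<union> (P - Popt))"
    by (intro measure_pmf.finite_measure_mono) (auto simp: outside_def)
  also have "\<dots> \<le> measure_pmf.prob unif (far_inliers c) + measure_pmf.prob unif (P - Popt)"
    by (intro measure_Un_le) auto
  finally show ?thesis unfolding prob_unif_outliers by linarith
qed

lemma prob_far_ge:
  assumes xs: "xs \<in> set_pmf (replicate_pmf n' unif)"
  shows "forced_hits t' (far_inliers c) (P - Popt) xs / t'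
    \<le> measure_pmf.prob (pmf_of_multiset (far c xs)) (far_inliers c)"
proof -
  let ?s = "size (filter_mset (\<lambda>x. x \<in> far_inliers c) (far c xs))"
  have far_inliers: "far_inliers c = {x \<in> Popt. (1 + \<epsilon>) * R < dist x c}"
    unfolding outside_def using Popt(1) by auto
  have "forced_hits t' (far_inliers c) (P - Popt) xs \<le> ?s"
    using farthest_points_size_ge[OF far _ far_inliers] xs by (simp add: set_sample)
  then have "forced_hits t' (far_inliers c) (P - Popt) xs / t' \<le> ?s / t'"
    by (intro divide_right_mono) auto
  also have "\<dots> \<le> ?s / size (far c xs)"
    using far_nonempty[OF xs] size_far_le[OF xs] t'_pos
    by (intro divide_left_mono mult_pos_pos) (auto simp: nonempty_has_size)
  finally show ?thesis
    unfolding prob_pmf_of_multiset[OF far_nonempty[OF xs]] .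
qed

lemma expectation_forced_hits_far_inliers_ge:
  assumes many: "(\<gamma> + \<delta> / 5) * card P < card (outside c)"
  shows "13 / 24 * (1 - \<eta>\<^sub>1) * (n' * \<delta> / 5)
    \<le> measure_pmf.expectation (replicate_pmf n' unif) (forced_hits t' (far_inliers c) (P - Popt))"
proof (rule expectation_forced_hits_ge_confidence)
  show "n' * \<delta> / 5 \<le> n' * measure_pmf.prob unif (far_inliers c)"
    using mult_left_mono[OF prob_unif_far_inliers_ge[OF many], of "real n'"] by simp
  show "n' * \<gamma> = n' * measure_pmf.prob unif (P - Popt)" unfolding prob_unif_outliers ..
  show "15 * (n' * \<delta> / 5) \<le> n' * \<gamma>" using delta n'_pos by simp
  show "real t' = 3 / 2 * (n' * \<gamma> + n' * \<delta> / 5)" unfolding t' by (simp add: algebra_simps)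
qed (use eta1 n' n'_pos delta in auto)

lemma far_inliers_share_eq: "n' * \<delta> / 5 / t' = 2 * selection_rate"
proof -
  define A where "A = \<gamma> + \<delta> / 5"
  have "0 < A" unfolding A_def using delta gamma by simp
  then show ?thesis
    unfolding t' selection_rate_def A_def[symmetric] add.commute[of "\<delta> / 5"] using n'_pos
    by (simp add: field_simps)
qed

lemma prob_next_point_ge:
  assumes many: "(\<gamma> + \<delta> / 5) * card P < card (outside c)"
  shows "13 / 12 * (1 - \<eta>\<^sub>1) * selection_rate \<le> measure_pmf.prob (next_point c) (far_inliers c)"
proof -
  let ?M = "replicate_pmf n' unif"
    and ?m = "forced_hits t' (far_inliers c) (P - Popt)"
    and ?q = "\<lambda>xs. measure_pmf.prob (pmf_of_multiset (far c xs)) (far_inliers c)"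
  have "13 / 12 * (1 - \<eta>\<^sub>1) * selection_rate = 13 / 24 * (1 - \<eta>\<^sub>1) * (n' * \<delta> / 5 / t')"
    unfolding far_inliers_share_eq by simp
  also have "\<dots> = 13 / 24 * (1 - \<eta>\<^sub>1) * (n' * \<delta> / 5) / t'"
    by (simp only: times_divide_eq_right)
  also have "\<dots> \<le> measure_pmf.expectation ?M ?m / t'"
    by (intro divide_right_mono expectation_forced_hits_far_inliers_ge many) simp
  also have "\<dots> = measure_pmf.expectation ?M (\<lambda>xs. real (?m xs) / t')" by simp
  also have "\<dots> \<le> measure_pmf.expectation ?M ?q"
  proof (rule integral_mono_AE)
    show "integrable ?M (\<lambda>xs. real (?m xs) / t')" by (rule integrable_forced_hits)
    show "integrable ?M ?q" by (rule measure_pmf.integrable_const_bound[of _ 1]) auto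
  qed (use prob_far_ge in \<open>auto simp: AE_measure_pmf_iff\<close>)
  also have "\<dots> = measure_pmf.prob (next_point c) (far_inliers c)"
    unfolding next_point_def prob_bind_pmf ..
  finally show ?thesis .
qed

subsection \<open>Growth of the minimum enclosing ball\<close>

text \<open>After \<open>j\<close> insertions of points at distance more than \<open>M\<close> from the current MEB center,
  \<open>Rad T / M > j / (j + 2)\<close>. With \<open>M = (1 + 2 / z) R\<close> this contradicts \<open>Rad T \<le> R\<close> at \<open>j = z\<close>.\<close>

definition grown :: "nat \<Rightarrow> 'a set \<Rightarrow> bool" where
  "grown j T \<longleftrightarrow> T \<subseteq> Popt \<and> T \<noteq> {} \<and> (j = 0 \<or> (1 + 2 / z) * R * j < Rad T * (j + 2))"

lemma dist_MEB_center_gt_if_outside: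
  assumes T: "T \<subseteq> Popt" "T \<noteq> {}" and q: "q \<in> outside (ctr T)"
  shows "(1 + 2 / z) * R < dist q (MEB_center T)"
proof -
  define \<xi> where "\<xi> = \<epsilon> / (2 + \<epsilon>) * (\<epsilon> / (1 + \<epsilon>))"
  have \<xi>: "0 \<le> \<xi>" unfolding \<xi>_def using eps by simp
  have "approx_MEB_center \<xi> T (ctr T)"
    unfolding \<xi>_def using ctr[of T] T Popt(1) by blast
  then have "dist (ctr T) (MEB_center T) \<le> \<xi> * Rad T"
    unfolding approx_MEB_center_def by (auto split: if_splits)
  also have "\<dots> \<le> \<xi> * R"
    using \<xi> Rad_le_R[OF T] by (intro mult_left_mono)
  finally have near: "dist (ctr T) (MEB_center T) \<le> \<xi> * R" .
  have "\<epsilon> - 2 / z = \<epsilon> / (2 + \<epsilon>) * \<epsilon>"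
    unfolding z using eps by (simp add: field_simps)
  moreover have "\<xi> \<le> \<epsilon> / (2 + \<epsilon>) * \<epsilon>"
    unfolding \<xi>_def using eps by (intro mult_left_mono) (auto simp: field_simps)
  ultimately have "(1 + 2 / z) * R \<le> (1 + \<epsilon> - \<xi>) * R"
    using R_nonneg by (intro mult_right_mono) linarith
  also have "\<dots> = (1 + \<epsilon>) * R - \<xi> * R" by (simp add: algebra_simps)
  also have "\<dots> < dist q (ctr T) - dist (ctr T) (MEB_center T)"
    using q near unfolding outside_def by auto
  also have "\<dots> \<le> dist q (MEB_center T)"
    using dist_triangle[of q "ctr T" "MEB_center T"] dist_commute[of "ctr T" "MEB_center T"] by simp
  finally show ?thesis .
qed

lemma grown_insert:
  assumes grown: "grown j T" and q: "q \<in> far_inliers (ctr T)"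
  shows "grown (Suc j) (insert q T)"
proof -
  have T: "T \<subseteq> Popt" "T \<noteq> {}" and bdd: "bounded T"
    using grown Popt(3) finite_subset finite_imp_bounded unfolding grown_def by auto
  have "(1 + 2 / z) * R * j \<le> Rad T * (real j + 2)"
    using grown Rad_nonneg[OF bdd T(2)] unfolding grown_def by auto
  then have "(1 + 2 / z) * R * (real j + 1) < Rad (insert q T) * (real j + 3)"
    using R_nonneg dist_MEB_center_gt_if_outside[OF T] q
    by (intro Rad_insert_ratio_step[OF bdd T(2)]) auto
  then show ?thesis
    using T q unfolding grown_def by (simp add: algebra_simps)
qed

lemma not_grown_z: "\<not> grown z T"
proof
  assume grown: "grown z T"
  then have "(1 + 2 / z) * R * z < Rad T * (real z + 2)"
    using z_pos unfolding grown_def by auto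
  moreover have "(1 + 2 / z) * R * z = R * (real z + 2)"
    using z_pos by (simp add: field_simps)
  ultimately have "R < Rad T" by (simp add: add_pos_pos mult_less_cancel_right)
  then show False
    using Rad_le_R[of T] grown unfolding grown_def by auto
qed

subsection \<open>The rounds\<close>

abbreviation "rounds \<equiv> meb_rounds P n' n'' t'' ctr far"
abbreviation "success_rate \<equiv> (1 - \<eta>\<^sub>1) * (1 - \<eta>\<^sub>2) * selection_rate"

lemma success_rate_nonneg: "0 \<le> success_rate"
  using selection_rate_pos eta1 eta2 by (intro mult_nonneg_nonneg) auto

lemma success_rate_le_cover: "success_rate \<le> 12 / 13 * (1 - \<eta>\<^sub>2)"
proof -
  have "selection_rate \<le> 12 / 13"
    unfolding selection_rate_def using delta gamma by (simp add: field_simps)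
  then have "(1 - \<eta>\<^sub>1) * selection_rate \<le> 1 * (12 / 13)"
    using selection_rate_pos eta1 by (intro mult_mono) auto
  then have "(1 - \<eta>\<^sub>2) * ((1 - \<eta>\<^sub>1) * selection_rate) \<le> (1 - \<eta>\<^sub>2) * (12 / 13)"
    using eta2 by (intro mult_left_mono) auto
  then show ?thesis by (simp only: mult_ac)
qed

lemma rounds_Suc:
  "rounds (Suc k) T = bind_pmf (next_point (ctr T)) (\<lambda>q. bind_pmf (replicate_pmf n'' unif) (\<lambda>ys.
     map_pmf (\<lambda>bs. (ctr T, radius_est (ctr T) ys) # bs) (rounds k (insert q T))))"
  unfolding next_point_def radius_est_def by (simp add: bind_assoc_pmf map_pmf_def)

lemma length_rounds: "bs \<in> set_pmf (rounds k T) \<Longrightarrow> length bs = k"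
  by (induction k arbitrary: T bs) auto

lemma prob_rounds_Suc_ge:
  assumes "0 \<le> r" and "\<And>q ys bs. q \<in> S \<Longrightarrow> ys \<in> Y \<Longrightarrow> bs \<in> B \<Longrightarrow> (ctr T, radius_est (ctr T) ys) # bs \<in> E"
    and "\<And>q. q \<in> S \<Longrightarrow> q \<in> P \<Longrightarrow> r \<le> measure_pmf.prob (rounds k (insert q T)) B"
  shows "measure_pmf.prob (next_point (ctr T)) S * (sample_prob n'' Y * r)
     \<le> measure_pmf.prob (rounds (Suc k) T) E"
  unfolding rounds_Suc
proof (intro prob_bind_pmf_ge)
  fix q ys assume q: "q \<in> set_pmf (next_point (ctr T))" "q \<in> S" and ys: "ys \<in> Y"
  let ?b = "(ctr T, radius_est (ctr T) ys)"
  have "r \<le> measure_pmf.prob (rounds k (insert q T)) B"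
    using assms(3) set_next_point q by blast
  also have "\<dots> \<le> measure_pmf.prob (rounds k (insert q T)) ((\<lambda>bs. ?b # bs) -` E)"
    using assms(2)[OF q(2) ys] by (intro measure_pmf.finite_measure_mono) auto
  finally show "r \<le> measure_pmf.prob (map_pmf (\<lambda>bs. ?b # bs) (rounds k (insert q T))) E"
    by simp
qed (use assms(1) in auto)

lemma prob_rounds_cover_ge:
  "success_rate ^ k \<le> measure_pmf.prob (rounds k T) {bs. \<forall>b\<in>set bs. covers b}"
proof (induction k arbitrary: T)
  case (Suc k)
  let ?Y = "{ys. covers (ctr T, radius_est (ctr T) ys)}"
  have "success_rate ^ Suc k \<le> sample_prob n'' ?Y * success_rate ^ k"
    using order_trans[OF success_rate_le_cover prob_covers_ge] success_rate_nonneg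
    unfolding power_Suc by (intro mult_right_mono) auto
  also have "\<dots> = measure_pmf.prob (next_point (ctr T)) UNIV
      * (sample_prob n'' ?Y * success_rate ^ k)"
    by simp
  also have "\<dots> \<le> measure_pmf.prob (rounds (Suc k) T) {bs. \<forall>b\<in>set bs. covers b}"
    by (rule prob_rounds_Suc_ge[OF _ _ Suc]) (use success_rate_nonneg in auto)
  finally show ?case .
qed simp

definition successful :: "('a \<times> real) list \<Rightarrow> bool" where
  "successful bs \<longleftrightarrow> (\<forall>b\<in>set bs. covers b) \<and> (\<exists>b\<in>set bs. approx b)"

lemma prob_good_round_ge:
  assumes few: "card (outside (ctr T)) \<le> (\<gamma> + \<delta> / 5) * card P"
  shows "success_rate ^ Suc k \<le> measure_pmf.prob (rounds (Suc k) T) {bs. successful bs}"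
proof -
  let ?Y = "{ys. approx (ctr T, radius_est (ctr T) ys)}"
  have "success_rate \<le> 1 * (1 - \<eta>\<^sub>2) * selection_rate"
    using selection_rate_pos eta1 eta2 by (intro mult_right_mono) auto
  also have "\<dots> \<le> sample_prob n'' ?Y"
    using prob_approx_ge[OF few] by simp
  finally have "success_rate ^ Suc k
      \<le> measure_pmf.prob (next_point (ctr T)) UNIV * (sample_prob n'' ?Y * success_rate ^ k)"
    using success_rate_nonneg by (simp add: mult_right_mono)
  also have "\<dots> \<le> measure_pmf.prob (rounds (Suc k) T) {bs. successful bs}"
    by (rule prob_rounds_Suc_ge[OF _ _ prob_rounds_cover_ge])
       (use success_rate_nonneg in \<open>auto simp: successful_def approx_iff\<close>)
  finally show ?thesis .
qed

lemma prob_bad_round_ge: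
  assumes many: "(\<gamma> + \<delta> / 5) * card P < card (outside (ctr T))"
    and next_rounds: "\<And>q. q \<in> far_inliers (ctr T) \<Longrightarrow>
      success_rate ^ k \<le> measure_pmf.prob (rounds k (insert q T)) {bs. successful bs}"
  shows "success_rate ^ Suc k \<le> measure_pmf.prob (rounds (Suc k) T) {bs. successful bs}"
proof -
  let ?S = "far_inliers (ctr T)" and ?Y = "{ys. covers (ctr T, radius_est (ctr T) ys)}"
  have "u * v * w = (13 / 12 * u * w) * (12 / 13 * v)" for u v w :: real by simp
  then have "success_rate = (13 / 12 * (1 - \<eta>\<^sub>1) * selection_rate) * (12 / 13 * (1 - \<eta>\<^sub>2))" .
  also have "\<dots> \<le> measure_pmf.prob (next_point (ctr T)) ?S * sample_prob n'' ?Y"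
    using eta2 by (intro mult_mono prob_next_point_ge[OF many] prob_covers_ge) auto
  finally have "success_rate ^ Suc k
      \<le> measure_pmf.prob (next_point (ctr T)) ?S * sample_prob n'' ?Y * success_rate ^ k"
    using success_rate_nonneg unfolding power_Suc by (intro mult_right_mono) auto
  also have "\<dots> \<le> measure_pmf.prob (rounds (Suc k) T) {bs. successful bs}"
    unfolding mult.assoc[of _ _ "success_rate ^ k"]
    by (rule prob_rounds_Suc_ge[OF _ _ next_rounds])
       (use success_rate_nonneg in \<open>auto simp: successful_def\<close>)
  finally show ?thesis .
qed

lemma prob_rounds_successful_ge:
  assumes "grown j T" "j + k = z"
  shows "success_rate ^ k \<le> measure_pmf.prob (rounds k T) {bs. successful bs}"
  using assms
proof (induction k arbitrary: j T)
  case 0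
  then show ?case using not_grown_z by simp
next
  case (Suc k)
  show ?case
  proof (cases "card (outside (ctr T)) \<le> (\<gamma> + \<delta> / 5) * card P")
    case True
    then show ?thesis by (rule prob_good_round_ge)
  next
    case False
    moreover have "success_rate ^ k \<le> measure_pmf.prob (rounds k (insert q T)) {bs. successful bs}"
      if "q \<in> far_inliers (ctr T)" for q
      using Suc.IH[OF grown_insert[OF Suc.prems(1) that]] Suc.prems(2) by simp
    ultimately show ?thesis by (intro prob_bad_round_ge) auto
  qed
qed

lemma approx_nth_arg_min:
  assumes "successful bs" "length bs = z"
  shows "approx (bs ! arg_min_on (\<lambda>i. snd (bs ! i)) {..<z})"
proof -
  let ?i = "arg_min_on (\<lambda>i. snd (bs ! i)) {..<z}"
  have indices: "finite {..<z}" "{..<z} \<noteq> {}" using z_pos by auto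
  have i: "?i < z" using arg_min_if_finite(1)[OF indices] by simp
  obtain k where k: "k < z" "approx (bs ! k)"
    using assms unfolding successful_def by (metis in_set_conv_nth)
  have "snd (bs ! ?i) \<le> snd (bs ! k)"
    using arg_min_least[OF indices, of k "\<lambda>i. snd (bs ! i)"] k by simp
  moreover have "covers (bs ! ?i)" using assms i unfolding successful_def by simp
  ultimately show ?thesis using k unfolding approx_iff by auto
qed

theorem prob_meb_algorithm_approx_ge:
  "(1 - \<gamma>) * success_rate ^ z
    \<le> measure_pmf.prob (meb_algorithm P n' n'' t'' ctr far z) {B. approx B}"
proof -
  let ?best = "\<lambda>bs :: ('a \<times> real) list. bs ! arg_min_on (\<lambda>i. snd (bs ! i)) {..<z}"
  have "P \<inter> Popt = Popt" using Popt by auto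
  then have "(1 - \<gamma>) * success_rate ^ z = measure_pmf.prob unif Popt * success_rate ^ z"
    unfolding prob_unif using Popt(4) card_P_pos by simp
  also have "\<dots> \<le> measure_pmf.prob (meb_algorithm P n' n'' t'' ctr far z) {B. approx B}"
    unfolding meb_algorithm_def
  proof (rule prob_bind_pmf_ge)
    fix p assume "p \<in> Popt"
    then have "success_rate ^ z \<le> measure_pmf.prob (rounds z {p}) {bs. successful bs} * 1"
      using prob_rounds_successful_ge[of 0 "{p}" z] unfolding grown_def by simp
    also have "\<dots>
        \<le> measure_pmf.prob (bind_pmf (rounds z {p}) (\<lambda>bs. return_pmf (?best bs))) {B. approx B}"
      by (rule prob_bind_pmf_ge) (auto simp: approx_nth_arg_min length_rounds)
    finally show "success_rate ^ z
        \<le> measure_pmf.prob (bind_pmf (rounds z {p}) (\<lambda>bs. return_pmf (?best bs))) {B. approx B}" .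
  qed (use success_rate_nonneg in simp)
  finally show ?thesis .
qed

end

lemma mult_one_minus_le_mult_ln_inverse:
  fixes C K \<eta> :: real
  assumes "0 \<le> K" "K \<le> C" "0 < \<eta>" "\<eta> < 1"
  shows "K * (1 - \<eta>) \<le> C * ln (1 / \<eta>)"
  using assms ln_le_minus_one[of \<eta>] by (intro mult_mono) (auto simp: ln_div)

theorem theorem6:
  fixes P Popt :: "(real ^ 'd) set"
    and \<gamma> \<epsilon> \<eta>\<^sub>1 \<eta>\<^sub>2 \<delta> s C\<^sub>1 C\<^sub>2 :: real
    and z n' n'' t' t'' :: nat
    and ctr :: "(real ^ 'd) set \<Rightarrow> real ^ 'd"
    and far :: "real ^ 'd \<Rightarrow> (real ^ 'd) list \<Rightarrow> (real ^ 'd) multiset"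
  assumes "finite P" "P \<noteq> {}"
    and "0 < \<gamma>" "\<gamma> < 1" "0 < \<epsilon>" "\<epsilon> < 1"
    and "0 < \<eta>\<^sub>1" "\<eta>\<^sub>1 < 1" "0 < \<eta>\<^sub>2" "\<eta>\<^sub>2 < 1"
    and "0 < \<delta>" "\<delta> < \<gamma> / 3"
    and "outlier_opt P \<gamma> Popt"
    and "real z = 2 / \<epsilon> + 1"
    and "C\<^sub>1 \<ge> 10 ^ 9" "real n' = C\<^sub>1 * (1 / \<delta> * ln (1 / \<eta>\<^sub>1))"
    and "C\<^sub>2 \<ge> 10 ^ 9" "real n'' = C\<^sub>2 * (\<gamma> / \<delta>\<^sup>2 * ln (1 / \<eta>\<^sub>2))"
    and "real t' = 3 / 2 * (\<delta> / 5 + \<gamma>) * real n'"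
    and "real t'' = (1 + \<delta> / (5 * \<gamma>))\<^sup>2 * \<gamma> * real n''"
    and "s = \<epsilon> / (2 + \<epsilon>)"
    and "\<And>T. T \<subseteq> P \<Longrightarrow> T \<noteq> {} \<Longrightarrow> approx_MEB_center (s * (\<epsilon> / (1 + \<epsilon>))) T (ctr T)"
    and "\<And>c xs. farthest_points t' c xs (far c xs)"
  shows "measure_pmf.prob (meb_algorithm P n' n'' t'' ctr far z)
           {B. outlier_approx P \<gamma> Popt \<epsilon> \<delta> B}
         \<ge> (1 - \<gamma>) * ((1 - \<eta>\<^sub>1) * (1 - \<eta>\<^sub>2) * ((\<delta> / 5) / (3 * (\<gamma> + \<delta> / 5)))) ^ z"
proof -
  have "5 * 10 ^ 7 * (1 - \<eta>\<^sub>1) \<le> n' * \<delta>"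
    using mult_one_minus_le_mult_ln_inverse[of "5 * 10 ^ 7" C\<^sub>1 \<eta>\<^sub>1] assms by simp
  moreover have "1000 * (1 - \<eta>\<^sub>2) * \<gamma> \<le> n'' * \<delta>\<^sup>2"
    using mult_right_mono[OF mult_one_minus_le_mult_ln_inverse[of 1000 C\<^sub>2 \<eta>\<^sub>2], of \<gamma>] assms by simp
  ultimately interpret outlier_sampling P Popt \<gamma> \<epsilon> \<eta>\<^sub>1 \<eta>\<^sub>2 \<delta> z n' n'' t' t'' ctr far
    using assms by unfold_locales auto
  show ?thesis
    using prob_meb_algorithm_approx_ge unfolding selection_rate_def .
qed

end
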